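(* Let $\mathbb{T}^3(\mathbb{R}^2)$ be the space of third-order tensors on $\mathbb{R}^2$ (no index symmetry), and let $\mathbf{T}=(z_{1a},z_{1b},z_{1c},z_3)$ be the complex components of $\mathbf{T}$ in a fixed explicit harmonic decomposition $\mathbb{T}^3(\mathbb{R}^2)\simeq3\,\mathbb{H}^1(\mathbb{R}^2)\oplus\mathbb{H}^3(\mathbb{R}^2)$. Let $\mathcal{L}$ be the following list of $26$ monomials: order 0: $z_{1a}\overline{z}_{1b}$, $z_{1a}\overline{z}_{1c}$, $z_{1b}\overline{z}_{1c}$, $z_{1a}^3\overline{z}_3$, $z_{1b}^3\overline{z}_3$, $z_{1c}^3\overline{z}_3$, $z_{1a}z_{1b}^2\overline{z}_3$, $z_{1b}z_{1c}^2\overline{z}_3$, $z_{1b}^2z_{1c}\overline{z}_3$, $z_{1a}^2z_{1c}\overline{z}_3$, $z_{1a}^2z_{1b}\overline{z}_3$, $z_{1a}z_{1c}^2\overline{z}_3$, $z_{1a}z_{1b}z_{1c}\overline{z}_3$; order 1: $\overline{z}_{1a}z$, $\overline{z}_{1b}z$, $\overline{z}_{1c}z$, $z_{1a}^2\overline{z}_3z$, $z_{1b}^2\overline{z}_3z$, $z_{1c}^2\overline{z}_3z$, $z_{1a}z_{1b}\overline{z}_3z$, $z_{1a}z_{1c}\overline{z}_3z$, $z_{1b}z_{1c}\overline{z}_3z$; order 2: $z_{1a}\overline{z}_3z^2$, $z_{1b}\overline{z}_3z^2$, $z_{1c}\overline{z}_3z^2$; order 3: $\overline{z}_3z^3$.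 Then: (1) a minimal integrity basis for $\mathrm{Cov}(\mathbb{T}^3(\mathbb{R}^2),\mathrm{SO}(2))$ consists of the $57$ covariants ($30$ of them invariants): $z_{1a}\overline{z}_{1a}$, $z_{1b}\overline{z}_{1b}$, $z_{1c}\overline{z}_{1c}$, $z_3\overline{z}_3$, $z\overline{z}$, and $\mathrm{Re}(\mathbf{m})$, $\mathrm{Im}(\mathbf{m})$ for $\mathbf{m}\in\mathcal{L}$; (2) a minimal integrity basis for $\mathrm{Cov}(\mathbb{T}^3(\mathbb{R}^2),\mathrm{O}(2))$ consists of the $31$ covariants ($17$ of them invariants): $z_{1a}\overline{z}_{1a}$, $z_{1b}\overline{z}_{1b}$, $z_{1c}\overline{z}_{1c}$, $z_3\overline{z}_3$, $z\overline{z}$, and $\mathrm{Re}(\mathbf{m})$ for $\mathbf{m}\in\mathcal{L}$.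
   Context: $\mathrm{O}(2)$ is generated by rotations $r_\theta$ and $\sigma=\mathrm{diag}(1,-1)$; it acts on $\mathbb{T}^n(\mathbb{R}^2)=\otimes^n\mathbb{R}^2$ by $(\rho(g)\mathbf{T})_{i_1\cdots i_n}=g_{i_1j_1}\cdots g_{i_nj_n}T_{j_1\cdots j_n}$. For $n\ge1$, $\mathbb{H}^n(\mathbb{R}^2)$ is the two-dimensional irreducible representation where $r_\theta$ acts as rotation of angle $n\theta$ and $\sigma$ as $\mathrm{diag}(1,-1)$. An explicit harmonic decomposition is a choice of $\mathrm{O}(2)$-equivariant linear isomorphism with the indicated direct sum; a component $(a,b)$ in a factor $\mathbb{H}^n$ is encoded by a complex coordinate $z_{n\ast}=a+ib$ (letters $a,b,c$ label multiplicities), so $r_\theta$ acts by $z_{n\ast}\mapsto e^{in\theta}z_{n\ast}$ and $\sigma$ by complex conjugation. $\mathrm{Inv}(\mathbb{V},G)$ is the algebra of $G$-invariant real polynomials on $\mathbb{V}$; the covariant algebra is $\mathrm{Cov}(\mathbb{V},G):=\mathrm{Inv}(\mathbb{V}\oplus\mathbb{R}^2,G)$, $G$ acting on $\mathbb{R}^2\ni\mathbf{x}=(x,y)$ in the standard way; $z=x+iy$. The order of a covariant is its degree in $\mathbf{x}$; invariants are covariants of order $0$. An integrity basis is a finite set of homogeneous generators of the algebra; it is minimal if no proper subset generates. *)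

theory Defs
  imports "HOL-Analysis.Analysis" "HOL-Computational_Algebra.Polynomial"
begin

definition rot :: "real \<Rightarrow> real^2^2" where
  "rot \<theta> = vector [vector [cos \<theta>, - sin \<theta>], vector [sin \<theta>, cos \<theta>]]"

definition refl_x :: "real^2^2" where
  "refl_x = vector [vector [1, 0], vector [0, - 1]]"

definition O2 :: "(real^2^2) set" where
  "O2 = {g. orthogonal_matrix g}"

definition SO2 :: "(real^2^2) set" where
  "SO2 = {g. rotation_matrix g}"

type_synonym tensor3 = "real^2^2^2"

definition tensor_act :: "real^2^2 \<Rightarrow> tensor3 \<Rightarrow> tensor3" where
  "tensor_act g T = (\<chi> i j k. \<Sum>p\<in>UNIV. \<Sum>q\<in>UNIV. \<Sum>r\<in>UNIV.
     g $ i $ p * g $ j $ q * g $ k $ r * T $ p $ q $ r)"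

text \<open>The representation \<open>\<bbbH>\<^sup>n\<close> in its complex coordinate \<open>w = a + i b\<close>. The first column of both
  \<open>rot \<theta>\<close> and \<open>rot \<theta> ** refl_x\<close> is \<open>(cos \<theta>, sin \<theta>)\<close>, so \<open>Complex (g $ 1 $ 1) (g $ 2 $ 1)\<close> is
  \<open>cis \<theta>\<close> in either case. On \<open>O2\<close> this is the action in which \<open>rot \<theta>\<close> multiplies by
  \<open>cis (n * \<theta>)\<close> and \<open>refl_x\<close> conjugates; see the lemmas below.\<close>

definition harm_act :: "nat \<Rightarrow> real^2^2 \<Rightarrow> complex \<Rightarrow> complex" where
  "harm_act n g w = Complex (g $ 1 $ 1) (g $ 2 $ 1) ^ n * (if det g = 1 then w else cnj w)"

lemma harm_act_rot: "harm_act n (rot \<theta>) w = cis (real n * \<theta>) * w"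
proof -
  have "Complex (cos \<theta>) (sin \<theta>) = cis \<theta>" by (simp add: complex_eq_iff)
  then show ?thesis
    by (simp add: harm_act_def rot_def det_2 power2_eq_square[symmetric] Complex.DeMoivre[symmetric])
qed

lemma harm_act_refl: "harm_act n refl_x w = cnj w"
proof -
  have "Complex 1 0 = 1" by (simp add: complex_eq_iff)
  then show ?thesis by (simp add: harm_act_def refl_x_def det_2)
qed

lemma O2_cases:
  assumes "g \<in> O2"
  obtains \<theta> where "g = rot \<theta>" | \<theta> where "g = rot \<theta> ** refl_x"
proof -
  have t: "transpose g ** g = mat 1"
    using assms by (simp add: O2_def orthogonal_matrix)
  have e: "(transpose g ** g) $ i $ j = (mat 1 :: real^2^2) $ i $ j" for i j
    using t by simp
  have a: "(g$1$1)\<^sup>2 + (g$2$1)\<^sup>2 = 1"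
    using e[of 1 1] by (simp add: matrix_matrix_mult_def transpose_def mat_def sum_2 power2_eq_square)
  have c: "(g$1$2)\<^sup>2 + (g$2$2)\<^sup>2 = 1"
    using e[of 2 2] by (simp add: matrix_matrix_mult_def transpose_def mat_def sum_2 power2_eq_square)
  have b: "g$1$1 * g$1$2 + g$2$1 * g$2$2 = 0"
    using e[of 1 2] by (simp add: matrix_matrix_mult_def transpose_def mat_def sum_2)
  obtain \<theta> where th: "g$1$1 = cos \<theta>" "g$2$1 = sin \<theta>"
    using sincos_total_2pi[OF a] by metis
  define d where "d = det g"
  have d: "d = g$1$1 * g$2$2 - g$1$2 * g$2$1" by (simp add: d_def det_2)
  have "g$1$2 = - d * sin \<theta>" "g$2$2 = d * cos \<theta>"
    using a b unfolding d th by algebra+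
  moreover have "d = 1 \<or> d = - 1"
    using det_orthogonal_matrix assms by (auto simp: d_def O2_def)
  ultimately have "g = rot \<theta> \<or> g = rot \<theta> ** refl_x"
    by (auto simp: vec_eq_iff forall_2 rot_def refl_x_def matrix_matrix_mult_def sum_2 th)
  with that show ?thesis by blast
qed

lemma harm_act_mult:
  assumes "g \<in> O2" "h \<in> O2"
  shows "harm_act n (g ** h) w = harm_act n g (harm_act n h w)"
proof -
  define u where "u = (\<lambda>g :: real^2^2. Complex (g$1$1) (g$2$1))"
  have dt: "det k = 1 \<or> det k = - 1" if "k \<in> O2" for k :: "real^2^2"
    using det_orthogonal_matrix that by (auto simp: O2_def)
  have "det (rot \<theta>) = 1" for \<theta>
    by (simp add: rot_def det_2 power2_eq_square[symmetric])
  moreover have "det refl_x = - 1"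
    by (simp add: refl_x_def det_2)
  ultimately have "det (rot \<theta>) = 1" "det (rot \<theta> ** refl_x) = - 1" for \<theta>
    by (simp_all add: det_mul)
  then have u: "u (g ** h) = u g * (if det g = 1 then u h else cnj (u h))"
    by (rule_tac O2_cases[OF assms(1)])
      (simp_all add: u_def complex_eq_iff matrix_matrix_mult_def rot_def refl_x_def sum_2 algebra_simps)
  have h: "harm_act n k v = u k ^ n * (if det k = 1 then v else cnj v)" for k v
    by (simp add: harm_act_def u_def)
  show ?thesis
    using dt[OF assms(1)] dt[OF assms(2)]
    by (auto simp: h u det_mul power_mult_distrib)
qed

text \<open>An explicit harmonic decomposition \<open>\<bbbT>\<^sup>3(\<real>\<^sup>2) \<simeq> 3 \<bbbH>\<^sup>1 \<oplus> \<bbbH>\<^sup>3\<close>, given by the coordinates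
  \<open>(z1a, z1b, z1c, z3)\<close>.\<close>

definition harmonic_decomposition ::
    "(tensor3 \<Rightarrow> complex \<times> complex \<times> complex \<times> complex) \<Rightarrow> bool" where
  "harmonic_decomposition \<phi> \<longleftrightarrow> linear \<phi> \<and> bij \<phi> \<and>
     (\<forall>g\<in>O2. \<forall>T. \<phi> (tensor_act g T) =
        (case \<phi> T of (a, b, c, d) \<Rightarrow>
           (harm_act 1 g a, harm_act 1 g b, harm_act 1 g c, harm_act 3 g d)))"

text \<open>Real polynomials on a finite-dimensional space are identified with the functions they induce
  (\<open>\<real>\<close> is infinite).\<close>

definition Inv :: "'g set \<Rightarrow> ('g \<Rightarrow> 'v \<Rightarrow> 'v) \<Rightarrow> ('v::euclidean_space \<Rightarrow> real) set" where
  "Inv G act = {p. real_polynomial_function p \<and> (\<forall>g\<in>G. \<forall>v. p (act g v) = p v)}"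

definition Cov ::
    "(real^2^2) set \<Rightarrow> (real^2^2 \<Rightarrow> 'v \<Rightarrow> 'v) \<Rightarrow> ('v::euclidean_space \<times> (real^2) \<Rightarrow> real) set" where
  "Cov G act = Inv G (\<lambda>g (v, x). (act g v, g *v x))"

text \<open>The degree in \<open>x\<close>: the least bound for the degrees of all restrictions
  \<open>t \<mapsto> p (v, t x)\<close>. (Meaningful for polynomial functions only; the zero function gets order \<open>0\<close>.)\<close>

definition cov_order :: "('v \<times> (real^2) \<Rightarrow> real) \<Rightarrow> nat" where
  "cov_order p = (LEAST k. \<forall>v x. \<exists>q :: real poly. degree q \<le> k \<and> (\<forall>t. p (v, t *\<^sub>R x) = poly q t))"

definition homogeneous :: "('v::real_vector \<Rightarrow> real) \<Rightarrow> bool" where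
  "homogeneous p \<longleftrightarrow> (\<exists>d::nat. \<forall>t v. p (t *\<^sub>R v) = t ^ d * p v)"

inductive_set generated_algebra :: "('v \<Rightarrow> real) set \<Rightarrow> ('v \<Rightarrow> real) set"
  for B :: "('v \<Rightarrow> real) set" where
  const: "(\<lambda>v. c) \<in> generated_algebra B"
| gen: "p \<in> B \<Longrightarrow> p \<in> generated_algebra B"
| add: "p \<in> generated_algebra B \<Longrightarrow> q \<in> generated_algebra B \<Longrightarrow>
    (\<lambda>v. p v + q v) \<in> generated_algebra B"
| mult: "p \<in> generated_algebra B \<Longrightarrow> q \<in> generated_algebra B \<Longrightarrow>
    (\<lambda>v. p v * q v) \<in> generated_algebra B"

definition integrity_basis :: "('v::real_vector \<Rightarrow> real) set \<Rightarrow> ('v \<Rightarrow> real) set \<Rightarrow> bool" where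
  "integrity_basis A B \<longleftrightarrow> finite B \<and> (\<forall>p\<in>B. homogeneous p) \<and> generated_algebra B = A"

definition minimal_integrity_basis :: "('v::real_vector \<Rightarrow> real) set \<Rightarrow> ('v \<Rightarrow> real) set \<Rightarrow> bool" where
  "minimal_integrity_basis A B \<longleftrightarrow>
     integrity_basis A B \<and> (\<forall>B'. B' \<subset> B \<longrightarrow> generated_algebra B' \<noteq> A)"

text \<open>Functions of the complex coordinates are written in the variables
  \<open>(a, b, c, d, z) = (z1a, z1b, z1c, z3, z)\<close>.\<close>

type_synonym coords = "complex \<times> complex \<times> complex \<times> complex \<times> complex"

definition coords :: "(tensor3 \<Rightarrow> complex \<times> complex \<times> complex \<times> complex) \<Rightarrow>
    tensor3 \<times> (real^2) \<Rightarrow> coords" where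
  "coords \<phi> = (\<lambda>(T, x). case \<phi> T of (a, b, c, d) \<Rightarrow> (a, b, c, d, Complex (x $ 1) (x $ 2)))"

text \<open>The monomials listed under order \<open>k\<close>.\<close>

definition monomials :: "nat \<Rightarrow> (coords \<Rightarrow> complex) set" where
  "monomials k =
    (if k = 0 then
      {\<lambda>(a, b, c, d, z). a * cnj b,
       \<lambda>(a, b, c, d, z). a * cnj c,
       \<lambda>(a, b, c, d, z). b * cnj c,
       \<lambda>(a, b, c, d, z). a^3 * cnj d,
       \<lambda>(a, b, c, d, z). b^3 * cnj d,
       \<lambda>(a, b, c, d, z). c^3 * cnj d,
       \<lambda>(a, b, c, d, z). a * b^2 * cnj d,
       \<lambda>(a, b, c, d, z). b * c^2 * cnj d,
       \<lambda>(a, b, c, d, z). b^2 * c * cnj d,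
       \<lambda>(a, b, c, d, z). a^2 * c * cnj d,
       \<lambda>(a, b, c, d, z). a^2 * b * cnj d,
       \<lambda>(a, b, c, d, z). a * c^2 * cnj d,
       \<lambda>(a, b, c, d, z). a * b * c * cnj d}
     else if k = 1 then
      {\<lambda>(a, b, c, d, z). cnj a * z,
       \<lambda>(a, b, c, d, z). cnj b * z,
       \<lambda>(a, b, c, d, z). cnj c * z,
       \<lambda>(a, b, c, d, z). a^2 * cnj d * z,
       \<lambda>(a, b, c, d, z). b^2 * cnj d * z,
       \<lambda>(a, b, c, d, z). c^2 * cnj d * z,
       \<lambda>(a, b, c, d, z). a * b * cnj d * z,
       \<lambda>(a, b, c, d, z). a * c * cnj d * z,
       \<lambda>(a, b, c, d, z). b * c * cnj d * z}
     else if k = 2 then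
      {\<lambda>(a, b, c, d, z). a * cnj d * z^2,
       \<lambda>(a, b, c, d, z). b * cnj d * z^2,
       \<lambda>(a, b, c, d, z). c * cnj d * z^2}
     else if k = 3 then
      {\<lambda>(a, b, c, d, z). cnj d * z^3}
     else {})"

definition all_monomials :: "(coords \<Rightarrow> complex) set" where
  "all_monomials = (\<Union>k. monomials k)"

definition square_norms :: "(coords \<Rightarrow> complex) set" where
  "square_norms =
     {\<lambda>(a, b, c, d, z). a * cnj a,
      \<lambda>(a, b, c, d, z). b * cnj b,
      \<lambda>(a, b, c, d, z). c * cnj c,
      \<lambda>(a, b, c, d, z). d * cnj d,
      \<lambda>(a, b, c, d, z). z * cnj z}"

definition re_part :: "(tensor3 \<Rightarrow> complex \<times> complex \<times> complex \<times> complex) \<Rightarrow>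
    (coords \<Rightarrow> complex) \<Rightarrow> tensor3 \<times> (real^2) \<Rightarrow> real" where
  "re_part \<phi> m = (\<lambda>v. Re (m (coords \<phi> v)))"

definition im_part :: "(tensor3 \<Rightarrow> complex \<times> complex \<times> complex \<times> complex) \<Rightarrow>
    (coords \<Rightarrow> complex) \<Rightarrow> tensor3 \<times> (real^2) \<Rightarrow> real" where
  "im_part \<phi> m = (\<lambda>v. Im (m (coords \<phi> v)))"

text \<open>The functions in \<open>square_norms\<close> are real-valued, so \<open>re_part\<close> only changes their type.\<close>

definition basis_SO2 :: "(tensor3 \<Rightarrow> complex \<times> complex \<times> complex \<times> complex) \<Rightarrow>
    (tensor3 \<times> (real^2) \<Rightarrow> real) set" where
  "basis_SO2 \<phi> =
     re_part \<phi> ` square_norms \<union> re_part \<phi> ` all_monomials \<union> im_part \<phi> ` all_monomials"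

definition basis_O2 :: "(tensor3 \<Rightarrow> complex \<times> complex \<times> complex \<times> complex) \<Rightarrow>
    (tensor3 \<times> (real^2) \<Rightarrow> real) set" where
  "basis_O2 \<phi> = re_part \<phi> ` square_norms \<union> re_part \<phi> ` all_monomials"

end

theory Submission
  imports Defs
begin

text \<open>
  In the coordinates \<open>(a, b, c, d, z)\<close> the decomposition turns tensor and vector together into
  \<open>\<complex>\<^sup>5\<close>, where the rotation by \<open>\<theta>\<close> multiplies \<open>a, b, c, z\<close> by \<open>cis \<theta>\<close> and \<open>d\<close> by \<open>cis (3 * \<theta>)\<close>,
  and the reflection conjugates everything. So the variable \<open>z\<close> is a fourth letter of weight one, and
  the two covariant algebras are the algebras of invariants of four letters of weight one and one
  letter of weight three. A linear change of variables carries minimal integrity bases to minimal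
  integrity bases (\<open>minimal_integrity_basis_pullback\<close>), and everything is done on \<open>\<complex>\<^sup>5\<close>. For letters
  \<open>u, v, w\<close> of weight one the listed monomials are the \<open>u * cnj v\<close> with \<open>u \<noteq> v\<close>, one from each
  conjugate pair, and the twenty products \<open>u * v * w * cnj d\<close>.

  Rotations. Written in the letters and their conjugates, a polynomial is a complex combination of
  words, each of which a rotation multiplies by a character. Averaging over the \<open>N\<close>-th roots of unity
  for large \<open>N\<close> keeps the words of weight zero only, and leaves an invariant polynomial unchanged. A
  word of weight zero splits into factors \<open>u * cnj v\<close>, \<open>d * cnj d\<close>, \<open>u * v * w * cnj d\<close> and their
  conjugates (\<open>word_generated\<close>), because after all factors of the first two kinds are removed only
  letters of one orientation remain, three of weight one against each of weight three.

  Reflections. Let \<open>A\<close> be the algebra generated by the real parts. If the product of any two imaginary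
  parts lies in \<open>A\<close>, then \<open>A\<close> plus the \<open>A\<close>-module spanned by the imaginary parts is closed under
  multiplication, so it contains all rotation invariants. The reflection fixes \<open>A\<close> and negates the
  module, so what it fixes is \<open>A\<close>. The products of imaginary parts are treated by Cramer's rule in the
  plane (\<open>Im_quad_Im_mult\<close>) and by computing \<open>Re (m * cnj m')\<close> in two ways (\<open>Im_quart_Im_quart\<close>).

  Minimality. Give the letters of weight one degree 1 and \<open>d\<close> degree 2. The generators then have degrees
  2, 4 and 5, and a product of two or more of them has degree at least 4 and different from 5. Hence a
  monomial of degree 2 or 5 that were generated by the others would be a linear combination of them
  (\<open>not_generated\<close>). On a suitable circle in \<open>\<complex>\<^sup>5\<close> the monomials are characters whose
  frequencies differ in absolute value (base 4 digits), so Fourier coefficients show that no such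
  combination exists. The five square norms are told apart by the coordinate axes.
\<close>

section \<open>Generated algebras and linear changes of variables\<close>

lemma generated_algebra_mono:
  assumes "f \<in> generated_algebra B" "B \<subseteq> C"
  shows "f \<in> generated_algebra C"
  using assms(1) by induction (use assms(2) in \<open>auto intro: generated_algebra.intros\<close>)

lemma generated_algebra_scale:
  "f \<in> generated_algebra B \<Longrightarrow> (\<lambda>v. c * f v) \<in> generated_algebra B"
  by (rule generated_algebra.mult[OF generated_algebra.const])

lemma generated_algebra_diff:
  assumes "f \<in> generated_algebra B" "g \<in> generated_algebra B"
  shows "(\<lambda>v. f v - g v) \<in> generated_algebra B"
  using generated_algebra.add[OF assms(1) generated_algebra_scale[OF assms(2), of "-1"]] by simp

lemma generated_algebra_pullback:
  "generated_algebra ((\<lambda>g. g \<circ> K) ` B) = (\<lambda>g. g \<circ> K) ` generated_algebra B"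
proof (intro equalityI subsetI)
  fix f assume "f \<in> generated_algebra ((\<lambda>g. g \<circ> K) ` B)"
  then show "f \<in> (\<lambda>g. g \<circ> K) ` generated_algebra B"
  proof induction
    case (const c)
    show ?case by (rule image_eqI[OF _ generated_algebra.const[of c]]) (simp add: fun_eq_iff)
  next
    case (gen p)
    then show ?case by (auto intro: generated_algebra.gen)
  next
    case (add p q)
    then obtain p' q' where "p = p' \<circ> K" "q = q' \<circ> K"
      "p' \<in> generated_algebra B" "q' \<in> generated_algebra B" by blast
    then show ?case
      by (intro image_eqI[OF _ generated_algebra.add[of p' _ q']]) (simp_all add: fun_eq_iff)
  next
    case (mult p q)
    then obtain p' q' where "p = p' \<circ> K" "q = q' \<circ> K"
      "p' \<in> generated_algebra B" "q' \<in> generated_algebra B" by blast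
    then show ?case
      by (intro image_eqI[OF _ generated_algebra.mult[of p' _ q']]) (simp_all add: fun_eq_iff)
  qed
next
  fix f assume "f \<in> (\<lambda>g. g \<circ> K) ` generated_algebra B"
  then obtain h where h: "h \<in> generated_algebra B" and f: "f = h \<circ> K" by blast
  from h have "h \<circ> K \<in> generated_algebra ((\<lambda>g. g \<circ> K) ` B)"
  proof induction
    case (const c)
    show ?case using generated_algebra.const[of c] by (simp add: o_def)
  next
    case (gen p)
    then show ?case by (auto intro: generated_algebra.gen)
  next
    case (add p q)
    then show ?case using generated_algebra.add by (fastforce simp: o_def)
  next
    case (mult p q)
    then show ?case using generated_algebra.mult by (fastforce simp: o_def)
  qed
  then show "f \<in> generated_algebra ((\<lambda>g. g \<circ> K) ` B)" by (simp add: f)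
qed

lemma inj_pullback: "surj K \<Longrightarrow> inj (\<lambda>g. g \<circ> K)"
  by (rule injI) (simp add: fun_eq_iff surj_def, metis)

text \<open>Composition with a surjection is injective and commutes with generating algebras, so the
  proper subsets of the two bases correspond to each other.\<close>
lemma minimal_integrity_basis_pullback:
  assumes "linear K" "surj K" "minimal_integrity_basis A B"
  shows "minimal_integrity_basis ((\<lambda>g. g \<circ> K) ` A) ((\<lambda>g. g \<circ> K) ` B)"
proof -
  have "homogeneous (g \<circ> K)" if "homogeneous g" for g
    using that assms(1) unfolding homogeneous_def o_def by (metis linear_cmul)
  moreover have "generated_algebra C \<noteq> (\<lambda>g. g \<circ> K) ` A" if C: "C \<subset> (\<lambda>g. g \<circ> K) ` B" for C
  proof -
    obtain B' where B': "B' \<subseteq> B" "C = (\<lambda>g. g \<circ> K) ` B'"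
      using C by (meson psubset_imp_subset subset_imageE)
    then have "B' \<subset> B" using C by blast
    then have "generated_algebra B' \<noteq> A"
      using assms(3) by (auto simp: minimal_integrity_basis_def)
    then show ?thesis
      unfolding B'(2) generated_algebra_pullback
      using inj_image_eq_iff[OF inj_pullback[OF assms(2)]] by blast
  qed
  ultimately show ?thesis
    using assms(3)
    by (auto simp: minimal_integrity_basis_def integrity_basis_def generated_algebra_pullback)
qed

text \<open>Generated algebras grow with the generators, so it suffices to remove one generator at a time.\<close>
lemma minimal_integrity_basisI:
  assumes "finite B" "\<And>p. p \<in> B \<Longrightarrow> homogeneous p" "generated_algebra B = A"
    and "\<And>q. q \<in> B \<Longrightarrow> q \<notin> generated_algebra (B - {q})"
  shows "minimal_integrity_basis A B"
proof -
  have "generated_algebra B' \<noteq> A" if B': "B' \<subset> B" for B'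
  proof
    assume eq: "generated_algebra B' = A"
    obtain q where q: "q \<in> B" "q \<notin> B'" using B' by blast
    have "q \<in> generated_algebra B'" using q(1) assms(3) eq generated_algebra.gen by blast
    then have "q \<in> generated_algebra (B - {q})"
      by (rule generated_algebra_mono) (use B' q in blast)
    then show False using assms(4) q(1) by blast
  qed
  then show ?thesis using assms(1-3) by (simp add: minimal_integrity_basis_def integrity_basis_def)
qed

section \<open>The monomials in terms of letters of weight one and three\<close>

text \<open>The letters of weight one, \<open>a, b, c, z\<close>, are numbered from 0 to 3. Their symmetry replaces the
  separate treatment of each order.\<close>
definition wone :: "nat \<Rightarrow> coords \<Rightarrow> complex" where
  "wone i = (\<lambda>(a, b, c, d, z). if i = 0 then a else if i = 1 then b else if i = 2 then c else z)"

definition wthree :: "coords \<Rightarrow> complex" where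
  "wthree = (\<lambda>(a, b, c, d, z). d)"

definition quad :: "nat \<Rightarrow> nat \<Rightarrow> coords \<Rightarrow> complex" where
  "quad i j = (\<lambda>x. wone i x * cnj (wone j x))"

definition quart :: "nat \<Rightarrow> nat \<Rightarrow> nat \<Rightarrow> coords \<Rightarrow> complex" where
  "quart i j k = (\<lambda>x. wone i x * wone j x * wone k x * cnj (wthree x))"

text \<open>The pairs with 3 in front stand for \<open>cnj u * z\<close>: the list contains this monomial and not its
  conjugate, which has the same real part and the opposite imaginary part.\<close>
definition quad_index :: "(nat \<times> nat) set" where
  "quad_index = {(0, 1), (0, 2), (1, 2), (3, 0), (3, 1), (3, 2)}"

lemma below_4: "k < 4 \<longleftrightarrow> k = 0 \<or> k = 1 \<or> k = 2 \<or> k = (3::nat)"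
  by auto

lemma quad_index_total:
  assumes "i < 4" "j < 4"
  shows "i = j \<or> (i, j) \<in> quad_index \<or> (j, i) \<in> quad_index"
  using assms unfolding below_4 by (elim disjE) (simp_all add: quad_index_def)

text \<open>With the covariable as a fourth letter, the 26 monomials are the 6 pairs and the 20 multisets
  of size three; the order counts the occurrences of the letter 3.\<close>
definition quart_index :: "(nat \<times> nat \<times> nat) set" where
  "quart_index = {(0,0,0), (0,0,1), (0,0,2), (0,0,3), (0,1,1), (0,1,2), (0,1,3), (0,2,2), (0,2,3),
     (0,3,3), (1,1,1), (1,1,2), (1,1,3), (1,2,2), (1,2,3), (1,3,3), (2,2,2), (2,2,3), (2,3,3),
     (3,3,3)}"

lemma quart_indexI:
  assumes "i \<le> j" "j \<le> k" "k < 4"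
  shows "(i, j, k) \<in> quart_index"
proof -
  have "i < 4" "j < 4" using assms by linarith+
  with assms show ?thesis
    unfolding below_4 by (elim disjE; simp add: quart_index_def)
qed

lemma UN_monomials: "all_monomials = monomials 0 \<union> monomials 1 \<union> monomials 2 \<union> monomials 3"
proof -
  have "monomials k = {}" if "k \<notin> {0, 1, 2, 3}" for k
    using that by (simp add: monomials_def)
  then have "(\<Union>k. monomials k) = (\<Union>k\<in>{0, 1, 2, 3}. monomials k)"
    by (intro equalityI UN_least subset_UNIV UN_mono) (metis SUP_upper bot.extremum, simp_all)
  then show ?thesis unfolding all_monomials_def by (simp add: Un_assoc)
qed

lemma wone_simps:
  "wone 0 = fst" "wone 1 = fst \<circ> snd" "wone 2 = fst \<circ> snd \<circ> snd"
  "wone 3 = snd \<circ> snd \<circ> snd \<circ> snd" "wthree = fst \<circ> snd \<circ> snd \<circ> snd"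
  by (simp_all add: wone_def wthree_def fun_eq_iff)

lemma monomials_0:
  "monomials 0 = {quad 0 1, quad 0 2, quad 1 2, quart 0 0 0, quart 1 1 1, quart 2 2 2, quart 0 1 1,
     quart 1 2 2, quart 1 1 2, quart 0 0 2, quart 0 0 1, quart 0 2 2, quart 0 1 2}"
  unfolding monomials_def if_P[OF refl]
  by (simp only: quad_def quart_def wone_simps case_prod_unfold power2_eq_square power3_eq_cube
      mult.assoc o_apply)

lemma monomials_1:
  "monomials 1 = {quad 3 0, quad 3 1, quad 3 2, quart 0 0 3, quart 1 1 3, quart 2 2 3, quart 0 1 3,
     quart 0 2 3, quart 1 2 3}"
proof -
  have "monomials 1 = (if (1::nat) = 1 then
      {\<lambda>(a, b, c, d, z). cnj a * z,
       \<lambda>(a, b, c, d, z). cnj b * z,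
       \<lambda>(a, b, c, d, z). cnj c * z,
       \<lambda>(a, b, c, d, z). a^2 * cnj d * z,
       \<lambda>(a, b, c, d, z). b^2 * cnj d * z,
       \<lambda>(a, b, c, d, z). c^2 * cnj d * z,
       \<lambda>(a, b, c, d, z). a * b * cnj d * z,
       \<lambda>(a, b, c, d, z). a * c * cnj d * z,
       \<lambda>(a, b, c, d, z). b * c * cnj d * z} else {})"
    unfolding monomials_def by (simp only: one_neq_zero if_False if_True refl)
  also have "\<dots> = {quad 3 0, quad 3 1, quad 3 2, quart 0 0 3, quart 1 1 3, quart 2 2 3, quart 0 1 3,
     quart 0 2 3, quart 1 2 3}"
    by (simp only: quad_def quart_def wone_simps case_prod_unfold power2_eq_square
      mult_ac o_apply if_P[OF refl])
  finally show ?thesis .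
qed

lemma monomials_2: "monomials 2 = {quart 0 3 3, quart 1 3 3, quart 2 3 3}"
  unfolding quart_def wone_simps
  by (simp add: monomials_def case_prod_unfold power2_eq_square mult_ac)

lemma monomials_3: "monomials 3 = {quart 3 3 3}"
  unfolding quart_def wone_simps
  by (simp add: monomials_def case_prod_unfold power3_eq_cube mult_ac)

lemma all_monomials_eq:
  "all_monomials = (\<lambda>(i, j). quad i j) ` quad_index \<union> (\<lambda>(i, j, k). quart i j k) ` quart_index"
  unfolding UN_monomials monomials_0 monomials_1 monomials_2 monomials_3 quad_index_def
    quart_index_def image_insert image_empty prod.case
  by (rule equalityI)
    (simp_all only: Un_insert_left Un_empty_left insert_subset insert_iff empty_subsetI simp_thms)

lemma square_norms_eq:
  "square_norms = {quad 0 0, quad 1 1, quad 2 2, (\<lambda>x. wthree x * cnj (wthree x)), quad 3 3}"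
  unfolding square_norms_def quad_def wone_def wthree_def by (simp add: case_prod_unfold)

lemma quad_in_all_monomials: "(i, j) \<in> quad_index \<Longrightarrow> quad i j \<in> all_monomials"
  unfolding all_monomials_eq by (rule UnI1, rule image_eqI[of _ _ "(i, j)"]) simp_all

lemma quart_in_all_monomials:
  assumes "i < 4" "j < 4" "k < 4"
  shows "quart i j k \<in> all_monomials"
proof -
  have mem: "quart i j k \<in> all_monomials" if "(i, j, k) \<in> quart_index" for i j k
    unfolding all_monomials_eq
    by (rule UnI2, rule image_eqI[of _ _ "(i, j, k)"]) (use that in simp_all)
  have "(i, j, k) \<in> quart_index \<or> (i, k, j) \<in> quart_index \<or> (j, i, k) \<in> quart_index
      \<or> (j, k, i) \<in> quart_index \<or> (k, i, j) \<in> quart_index \<or> (k, j, i) \<in> quart_index"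
    using assms quart_indexI by (metis nat_le_linear)
  moreover have "quart i j k = quart i k j" "quart i j k = quart j i k" "quart i j k = quart j k i"
    "quart i j k = quart k i j" "quart i j k = quart k j i"
    by (simp_all add: quart_def mult_ac)
  ultimately show ?thesis using mem by metis
qed

definition coord_basis_O2 :: "(coords \<Rightarrow> real) set" where
  "coord_basis_O2 = (\<lambda>m x. Re (m x)) ` (square_norms \<union> all_monomials)"

definition coord_basis_SO2 :: "(coords \<Rightarrow> real) set" where
  "coord_basis_SO2 = coord_basis_O2 \<union> (\<lambda>m x. Im (m x)) ` all_monomials"

lemma basis_pullback:
  "basis_SO2 \<phi> = (\<lambda>g. g \<circ> coords \<phi>) ` coord_basis_SO2"
  "basis_O2 \<phi> = (\<lambda>g. g \<circ> coords \<phi>) ` coord_basis_O2"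
  by (simp_all add: basis_SO2_def basis_O2_def coord_basis_SO2_def coord_basis_O2_def
      re_part_def im_part_def image_Un image_image o_def)

lemma Re_quad_in_basis:
  assumes "i < 4" "j < 4"
  shows "(\<lambda>x. Re (quad i j x)) \<in> coord_basis_O2"
proof -
  have sym: "(\<lambda>x. Re (quad i j x)) = (\<lambda>x. Re (quad j i x))" for i j
    by (simp add: quad_def mult.commute)
  have norm: "quad i i \<in> square_norms" if "i < 4" for i
    using that unfolding below_4 square_norms_eq by (elim disjE) simp_all
  have "quad i j \<in> square_norms \<union> all_monomials \<or> quad j i \<in> square_norms \<union> all_monomials"
    using quad_index_total[OF assms] norm[OF assms(1)] quad_in_all_monomials by blast
  then have "(\<lambda>x. Re (quad i j x)) \<in> coord_basis_O2 \<or> (\<lambda>x. Re (quad j i x)) \<in> coord_basis_O2"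
    unfolding coord_basis_O2_def by blast
  then show ?thesis using sym by metis
qed

lemma Re_norm_three_in_basis: "(\<lambda>x. Re (wthree x * cnj (wthree x))) \<in> coord_basis_O2"
proof -
  have "(\<lambda>x. Re (wthree x * cnj (wthree x))) \<in> (\<lambda>m x. Re (m x)) ` square_norms"
    unfolding square_norms_eq image_insert by (intro insertI2 insertI1)
  then show ?thesis unfolding coord_basis_O2_def image_Un by (rule UnI1)
qed

section \<open>Averages over roots of unity\<close>

text \<open>A geometric sum whose ratio is an \<open>N\<close>-th root of unity, different from 1 because \<open>N\<close> does not
  divide \<open>k\<close>.\<close>
lemma sum_cis_roots:
  fixes k :: int and N :: nat
  assumes "\<bar>k\<bar> < int N"
  shows "(\<Sum>j<N. cis (of_int k * (2 * pi * real j / real N))) = (if k = 0 then of_nat N else 0)"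
proof (cases "k = 0")
  case True
  then show ?thesis by simp
next
  case False
  define \<zeta> where "\<zeta> = cis (2 * pi * of_int k / real N)"
  have N: "N > 0" using assms by linarith
  have pow: "cis (of_int k * (2 * pi * real j / real N)) = \<zeta> ^ j" for j
    by (simp add: \<zeta>_def Complex.DeMoivre mult_ac)
  have "\<zeta> ^ N = cis (2 * pi * of_int k)"
    using N by (simp add: \<zeta>_def Complex.DeMoivre)
  also have "\<dots> = 1" by (rule cis_multiple_2pi) simp
  finally have one: "\<zeta> ^ N = 1" .
  have "\<zeta> \<noteq> 1"
  proof
    assume "\<zeta> = 1"
    then have "cos (2 * pi * of_int k / real N) = 1" by (simp add: \<zeta>_def complex_eq_iff)
    then obtain n :: int where "2 * pi * of_int k / real N = of_int n * 2 * pi"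
      using cos_one_2pi_int by blast
    then have "real_of_int k = of_int n * real N" using N by (simp add: field_simps)
    then have "k = n * int N" by (metis of_int_eq_iff of_int_mult of_int_of_nat_eq)
    then have "int N \<le> \<bar>k\<bar>" using dvd_imp_le_int[of k "int N"] False by simp
    then show False using assms by simp
  qed
  then have "(\<Sum>j<N. \<zeta> ^ j) = 0" by (simp add: geometric_sum one)
  then show ?thesis using False unfolding pow by simp
qed

section \<open>Invariants of the rotations\<close>

definition turn :: "real \<Rightarrow> coords \<Rightarrow> coords" where
  "turn \<theta> = (\<lambda>(a, b, c, d, z). (cis \<theta> * a, cis \<theta> * b, cis \<theta> * c, cis (3 * \<theta>) * d, cis \<theta> * z))"

definition inv_rot :: "(coords \<Rightarrow> real) set" where
  "inv_rot = {P. real_polynomial_function P \<and> (\<forall>\<theta> x. P (turn \<theta> x) = P x)}"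

lemma letters_turn:
  "wone i (turn \<theta> x) = cis \<theta> * wone i x" "wthree (turn \<theta> x) = cis (3 * \<theta>) * wthree x"
  by (simp_all add: wone_def wthree_def turn_def split: prod.splits)

text \<open>The complexification of the real algebra generated by \<open>B\<close>, in which monomials can be
  factored.\<close>
definition complex_algebra :: "(coords \<Rightarrow> real) set \<Rightarrow> (coords \<Rightarrow> complex) set" where
  "complex_algebra B =
    {F. (\<lambda>x. Re (F x)) \<in> generated_algebra B \<and> (\<lambda>x. Im (F x)) \<in> generated_algebra B}"

lemma complex_algebra_const: "(\<lambda>x. c) \<in> complex_algebra B"
  by (simp add: complex_algebra_def generated_algebra.const)

lemma complex_algebra_cnj: "F \<in> complex_algebra B \<Longrightarrow> (\<lambda>x. cnj (F x)) \<in> complex_algebra B"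
  using generated_algebra_scale[of "\<lambda>x. Im (F x)" B "-1"] by (simp add: complex_algebra_def)

lemma complex_algebra_add:
  "F \<in> complex_algebra B \<Longrightarrow> G \<in> complex_algebra B \<Longrightarrow> (\<lambda>x. F x + G x) \<in> complex_algebra B"
  by (simp add: complex_algebra_def generated_algebra.add)

lemma complex_algebra_mult:
  "F \<in> complex_algebra B \<Longrightarrow> G \<in> complex_algebra B \<Longrightarrow> (\<lambda>x. F x * G x) \<in> complex_algebra B"
  by (simp add: complex_algebra_def generated_algebra.add generated_algebra_diff
      generated_algebra.mult)

lemma all_monomials_complex_algebra:
  "m \<in> all_monomials \<Longrightarrow> m \<in> complex_algebra coord_basis_SO2"
  by (auto simp: complex_algebra_def coord_basis_SO2_def coord_basis_O2_def
      intro!: generated_algebra.gen)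

lemma norm_three_complex_algebra:
  "(\<lambda>x. wthree x * cnj (wthree x)) \<in> complex_algebra coord_basis_SO2"
proof -
  have "(\<lambda>x. Re (wthree x * cnj (wthree x))) \<in> generated_algebra coord_basis_SO2"
    unfolding coord_basis_SO2_def by (intro generated_algebra.gen UnI1 Re_norm_three_in_basis)
  then show ?thesis by (simp add: complex_algebra_def generated_algebra.const)
qed

lemma quad_complex_algebra:
  assumes "i < 4" "j < 4"
  shows "quad i j \<in> complex_algebra coord_basis_SO2"
proof -
  have sym: "quad j i = (\<lambda>x. cnj (quad i j x))" for i j by (simp add: quad_def mult.commute)
  consider "i = j" | "(i, j) \<in> quad_index" | "(j, i) \<in> quad_index"
    using quad_index_total[OF assms] by blast
  then show ?thesis
  proof cases
    case 1
    have "(\<lambda>x. Re (quad i i x)) \<in> generated_algebra coord_basis_SO2"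
      using Re_quad_in_basis[OF assms(1) assms(1)]
      by (auto simp: coord_basis_SO2_def intro: generated_algebra.gen)
    moreover have "(\<lambda>x. Im (quad i i x)) = (\<lambda>x. 0)" by (simp add: quad_def)
    ultimately show ?thesis by (simp add: 1 complex_algebra_def generated_algebra.const)
  next
    case 2
    then show ?thesis by (intro all_monomials_complex_algebra quad_in_all_monomials)
  next
    case 3
    then show ?thesis
      by (subst sym) (intro complex_algebra_cnj all_monomials_complex_algebra quad_in_all_monomials)
  qed
qed

text \<open>Words in the ten letters. Lists of letters of weight one, in place of exponents, let the
  factorisation below split off the first letters.\<close>
definition word :: "nat list \<Rightarrow> nat list \<Rightarrow> nat \<Rightarrow> nat \<Rightarrow> coords \<Rightarrow> complex" where
  "word us vs p q = (\<lambda>x. prod_list (map (\<lambda>i. wone i x) us) * prod_list (map (\<lambda>i. cnj (wone i x)) vs)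
     * wthree x ^ p * cnj (wthree x) ^ q)"

definition weight :: "nat list \<Rightarrow> nat list \<Rightarrow> nat \<Rightarrow> nat \<Rightarrow> int" where
  "weight us vs p q = int (length us) - int (length vs) + 3 * int p - 3 * int q"

lemma word_turn: "word us vs p q (turn \<theta> x) = cis (of_int (weight us vs p q) * \<theta>) * word us vs p q x"
proof -
  have us: "prod_list (map (\<lambda>i. wone i (turn \<theta> x)) us)
      = cis (real (length us) * \<theta>) * prod_list (map (\<lambda>i. wone i x) us)" for us
    by (induction us) (simp_all add: letters_turn cis_mult[symmetric] algebra_simps)
  have vs: "prod_list (map (\<lambda>i. cnj (wone i (turn \<theta> x))) vs)
      = cis (- real (length vs) * \<theta>) * prod_list (map (\<lambda>i. cnj (wone i x)) vs)" for vs
  proof (induction vs)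
    case (Cons i vs)
    have "cis (- real (length (i # vs)) * \<theta>) = cis (- \<theta>) * cis (- real (length vs) * \<theta>)"
      by (simp add: cis_mult algebra_simps)
    then show ?case using Cons by (simp add: letters_turn cis_cnj mult_ac)
  qed simp
  have e: "cis (of_int (weight us vs p q) * \<theta>)
      = cis (real (length us) * \<theta>) * cis (- real (length vs) * \<theta>) * cis (3 * \<theta>) ^ p * cis (- (3 * \<theta>)) ^ q"
    by (simp add: weight_def Complex.DeMoivre cis_mult algebra_simps)
  show ?thesis
    unfolding word_def us vs e unfolding letters_turn complex_cnj_mult cis_cnj power_mult_distrib
    by (simp only: mult_ac)
qed

text \<open>While both lists are nonempty a factor \<open>u * cnj v\<close> splits off, and while both exponents are
  positive a factor \<open>d * cnj d\<close> does. Otherwise all letters of weight one have one orientation and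
  those of weight three the other; since the weights balance, a remaining \<open>d\<close> or \<open>cnj d\<close> comes with
  at least three letters of weight one.\<close>
lemma word_generated:
  assumes "set us \<subseteq> {..<4}" "set vs \<subseteq> {..<4}" "length us + 3 * p = length vs + 3 * q"
  shows "word us vs p q \<in> complex_algebra coord_basis_SO2"
  using assms
proof (induction "length us + length vs + p + q" arbitrary: us vs p q rule: less_induct)
  case less
  note IH = less.hyps and prems = less.prems
  have three_elements: "\<exists>u1 u2 u3 us'. ws = u1 # u2 # u3 # us'" if "length ws \<ge> 3" for ws :: "nat list"
    using that by (auto simp: numeral_3_eq_3 Suc_le_length_iff)
  consider (pair) u us' v vs' where "us = u # us'" "vs = v # vs'"
    | (three) p' q' where "p = Suc p'" "q = Suc q'"
    | (up) u1 u2 u3 us' q' where "us = u1 # u2 # u3 # us'" "q = Suc q'"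
    | (down) v1 v2 v3 vs' p' where "vs = v1 # v2 # v3 # vs'" "p = Suc p'"
    | (trivial) "us = []" "vs = []" "p = 0" "q = 0"
  proof (cases "p = 0")
    case p: True
    show ?thesis
    proof (cases q)
      case 0
      then have "length us = length vs" using p prems by simp
      then show ?thesis using that(1,5) p 0 by (cases us; cases vs) auto
    next
      case (Suc q')
      then have "length us \<ge> 3" using p prems by simp
      then show ?thesis using that(3) Suc three_elements by blast
    qed
  next
    case False
    then obtain p' where p: "p = Suc p'" using not0_implies_Suc by blast
    show ?thesis
    proof (cases q)
      case 0
      then have "length vs \<ge> 3" using p prems by simp
      then show ?thesis using that(4) p three_elements by blast
    next
      case (Suc q')
      then show ?thesis using that(2) p by blast
    qed
  qed
  then show ?case
  proof cases
    case pair
    have "word us vs p q = (\<lambda>x. quad u v x * word us' vs' p q x)"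
      by (simp add: word_def pair quad_def mult_ac)
    moreover have "word us' vs' p q \<in> complex_algebra coord_basis_SO2"
      by (rule IH) (use prems pair in auto)
    moreover have "quad u v \<in> complex_algebra coord_basis_SO2"
      by (rule quad_complex_algebra) (use prems pair in auto)
    ultimately show ?thesis by (simp add: complex_algebra_mult)
  next
    case three
    have "word us vs p q = (\<lambda>x. (wthree x * cnj (wthree x)) * word us vs p' q' x)"
      by (simp add: word_def three mult_ac)
    moreover have "word us vs p' q' \<in> complex_algebra coord_basis_SO2"
      by (rule IH) (use prems three in auto)
    ultimately show ?thesis using complex_algebra_mult[OF norm_three_complex_algebra] by metis
  next
    case up
    have "word us vs p q = (\<lambda>x. quart u1 u2 u3 x * word us' vs p q' x)"
      by (simp add: word_def up quart_def mult_ac)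
    moreover have "word us' vs p q' \<in> complex_algebra coord_basis_SO2"
      by (rule IH) (use prems up in auto)
    moreover have "quart u1 u2 u3 \<in> complex_algebra coord_basis_SO2"
      by (intro all_monomials_complex_algebra quart_in_all_monomials) (use prems up in auto)
    ultimately show ?thesis by (simp add: complex_algebra_mult)
  next
    case down
    have "word us vs p q = (\<lambda>x. cnj (quart v1 v2 v3 x) * word us vs' p' q x)"
      by (simp add: word_def down quart_def mult_ac)
    moreover have "word us vs' p' q \<in> complex_algebra coord_basis_SO2"
      by (rule IH) (use prems down in auto)
    moreover have "(\<lambda>x. cnj (quart v1 v2 v3 x)) \<in> complex_algebra coord_basis_SO2"
      by (intro complex_algebra_cnj all_monomials_complex_algebra quart_in_all_monomials)
        (use prems down in auto)
    ultimately show ?thesis by (simp add: complex_algebra_mult)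
  next
    case trivial
    have "word us vs p q = (\<lambda>x. 1)" by (simp add: word_def trivial)
    then show ?thesis by (simp add: complex_algebra_const)
  qed
qed

inductive_set word_span :: "(coords \<Rightarrow> complex) set" where
  summand: "set us \<subseteq> {..<4} \<Longrightarrow> set vs \<subseteq> {..<4} \<Longrightarrow> (\<lambda>x. c * word us vs p q x) \<in> word_span"
| add: "F \<in> word_span \<Longrightarrow> G \<in> word_span \<Longrightarrow> (\<lambda>x. F x + G x) \<in> word_span"

lemma word_span_mult:
  assumes "F \<in> word_span" "G \<in> word_span"
  shows "(\<lambda>x. F x * G x) \<in> word_span"
proof -
  have summand: "(\<lambda>x. c * word us vs p q x * G x) \<in> word_span"
    if "set us \<subseteq> {..<4}" "set vs \<subseteq> {..<4}" for c us vs p q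
    using assms(2)
  proof induction
    case (summand us' vs' c' p' q')
    have "(\<lambda>x. c * word us vs p q x * (c' * word us' vs' p' q' x))
        = (\<lambda>x. (c * c') * word (us @ us') (vs @ vs') (p + p') (q + q') x)"
      by (simp add: word_def power_add mult_ac)
    then show ?case using summand that by (simp add: word_span.summand)
  next
    case (add F G)
    then show ?case using word_span.add[OF add.IH] by (simp add: distrib_left)
  qed
  show ?thesis
    using assms(1)
  proof induction
    case (add F F')
    then show ?case using word_span.add[OF add.IH] by (simp add: distrib_right)
  qed (rule summand)
qed

lemma word_span_const: "(\<lambda>x. c) \<in> word_span"
  using word_span.summand[of "[]" "[]" c 0 0] by (simp add: word_def)

lemma word_span_scale: "F \<in> word_span \<Longrightarrow> (\<lambda>x. c * F x) \<in> word_span"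
  by (rule word_span_mult[OF word_span_const])

lemma word_span_letters:
  assumes "i < 4"
  shows "wone i \<in> word_span" "(\<lambda>x. cnj (wone i x)) \<in> word_span"
    "wthree \<in> word_span" "(\<lambda>x. cnj (wthree x)) \<in> word_span"
  using word_span.summand[of "[i]" "[]" 1 0 0] word_span.summand[of "[]" "[i]" 1 0 0]
    word_span.summand[of "[]" "[]" 1 1 0] word_span.summand[of "[]" "[]" 1 0 1] assms
  by (simp_all add: word_def)

text \<open>Real linear forms on \<open>\<complex>\<close> are complex combinations of the coordinate and its conjugate; this
  is why polynomials are combinations of words.\<close>
lemma linear_on_complex_line:
  fixes h :: "complex \<Rightarrow> real"
  assumes "linear h"
  shows "complex_of_real (h u) = (h 1 - \<i> * h \<i>) / 2 * u + (h 1 + \<i> * h \<i>) / 2 * cnj u"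
proof -
  have "u = Re u *\<^sub>R 1 + Im u *\<^sub>R \<i>" by (simp add: complex_eq_iff)
  then have "h u = h (Re u *\<^sub>R 1 + Im u *\<^sub>R \<i>)" by (rule arg_cong)
  then have "h u = Re u * h 1 + Im u * h \<i>"
    by (simp only: linear_add[OF assms] linear_cmul[OF assms] real_scaleR_def)
  then show ?thesis by (simp add: complex_eq_iff field_simps)
qed

lemma polynomial_in_word_span:
  assumes "real_polynomial_function P"
  shows "(\<lambda>x. complex_of_real (P x)) \<in> word_span"
  using assms
proof induction
  case (linear f)
  then have lin: "linear f" by (rule bounded_linear.linear)
  define emb :: "nat \<Rightarrow> complex \<Rightarrow> coords" where
    "emb i u = (if i = 0 then (u, 0, 0, 0, 0) else if i = 1 then (0, u, 0, 0, 0)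
      else if i = 2 then (0, 0, u, 0, 0) else if i = 3 then (0, 0, 0, 0, u) else (0, 0, 0, u, 0))" for i u
  have "linear (f \<circ> emb i)" for i
    by (rule linear_compose[OF _ lin], rule linearI) (simp_all add: emb_def)
  then have "complex_of_real (f (emb i u)) = (f (emb i 1) - \<i> * f (emb i \<i>)) / 2 * u
      + (f (emb i 1) + \<i> * f (emb i \<i>)) / 2 * cnj u" for i u
    using linear_on_complex_line[of "f \<circ> emb i" u] by (simp only: o_apply)
  then have split: "\<exists>\<alpha> \<beta>. \<forall>u. complex_of_real (f (emb i u)) = \<alpha> * u + \<beta> * cnj u" for i by blast
  have comp: "(\<lambda>x. complex_of_real (f (emb i (w x)))) \<in> word_span"
    if "w \<in> word_span" "(\<lambda>x. cnj (w x)) \<in> word_span" for i and w :: "coords \<Rightarrow> complex"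
  proof -
    obtain \<alpha> \<beta> where "\<And>u. complex_of_real (f (emb i u)) = \<alpha> * u + \<beta> * cnj u" using split by blast
    then show ?thesis using word_span.add[OF word_span_scale word_span_scale, OF that] by simp
  qed
  have one: "(\<lambda>x. complex_of_real (f (emb i (wone j x)))) \<in> word_span" if "j < 4" for i j
    by (intro comp word_span_letters that)
  have three: "(\<lambda>x. complex_of_real (f (emb i (wthree x)))) \<in> word_span" for i
    by (intro comp word_span_letters[of 0]) simp_all
  have "x = emb 0 (wone 0 x) + (emb 1 (wone 1 x) + (emb 2 (wone 2 x) + (emb 3 (wone 3 x)
      + emb 4 (wthree x))))" for x
    by (simp add: emb_def wone_def wthree_def split: prod.splits)
  then have "f x = f (emb 0 (wone 0 x) + (emb 1 (wone 1 x) + (emb 2 (wone 2 x)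
      + (emb 3 (wone 3 x) + emb 4 (wthree x)))))" for x
    by (rule arg_cong)
  also have "\<dots> x = f (emb 0 (wone 0 x)) + (f (emb 1 (wone 1 x)) + (f (emb 2 (wone 2 x))
      + (f (emb 3 (wone 3 x)) + f (emb 4 (wthree x)))))" for x
    by (simp only: linear_add[OF lin])
  finally have "complex_of_real (f x) = complex_of_real (f (emb 0 (wone 0 x))
      + (f (emb 1 (wone 1 x)) + (f (emb 2 (wone 2 x))
      + (f (emb 3 (wone 3 x)) + f (emb 4 (wthree x))))))" for x
    by (rule arg_cong)
  then have eq: "(\<lambda>x. complex_of_real (f x)) = (\<lambda>x. complex_of_real (f (emb 0 (wone 0 x)))
      + (complex_of_real (f (emb 1 (wone 1 x))) + (complex_of_real (f (emb 2 (wone 2 x)))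
      + (complex_of_real (f (emb 3 (wone 3 x))) + complex_of_real (f (emb 4 (wthree x)))))))"
    unfolding of_real_add by (rule ext)
  show ?case
    by (subst eq, intro word_span.add one three) simp_all
next
  case (const c)
  show ?case by (rule word_span_const)
next
  case (add f g)
  then show ?case using word_span.add by fastforce
next
  case (mult f g)
  then show ?case using word_span_mult by fastforce
qed

text \<open>A word of weight \<open>k\<close> with \<open>\<bar>k\<bar> < N\<close> is killed by the average unless \<open>k = 0\<close>, and the words of
  weight zero are generated. A combination of words needs an \<open>N\<close> above all its weights.\<close>
lemma average_word_span:
  assumes "F \<in> word_span"
  shows "\<exists>N0>0. \<forall>N\<ge>N0. (\<lambda>x. (\<Sum>j<N. F (turn (2 * pi * real j / real N) x)) / of_nat N)
    \<in> complex_algebra coord_basis_SO2"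
  using assms
proof induction
  case (summand us vs c p q)
  define k where "k = weight us vs p q"
  show ?case
  proof (intro exI[of _ "Suc (nat \<bar>k\<bar>)"] conjI allI impI)
    fix N assume N: "Suc (nat \<bar>k\<bar>) \<le> N"
    then have kN: "\<bar>k\<bar> < int N" "N > 0" by linarith+
    have "(\<Sum>j<N. c * word us vs p q (turn (2 * pi * real j / real N) x)) / of_nat N
        = (\<Sum>j<N. cis (of_int k * (2 * pi * real j / real N))) * (c * word us vs p q x) / of_nat N" for x
      unfolding word_turn k_def[symmetric] by (simp add: sum_distrib_right sum_distrib_left mult_ac)
    then have avg: "(\<Sum>j<N. c * word us vs p q (turn (2 * pi * real j / real N) x)) / of_nat N
        = (if k = 0 then c * word us vs p q x else 0)" for x
      unfolding sum_cis_roots[OF kN(1)] using kN(2) by simp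
    show "(\<lambda>x. (\<Sum>j<N. c * word us vs p q (turn (2 * pi * real j / real N) x)) / of_nat N)
        \<in> complex_algebra coord_basis_SO2"
    proof (cases "k = 0")
      case True
      then have "length us + 3 * p = length vs + 3 * q" by (simp add: k_def weight_def)
      then have "word us vs p q \<in> complex_algebra coord_basis_SO2"
        by (rule word_generated[OF summand])
      then show ?thesis unfolding avg
        using True by (simp add: complex_algebra_mult[OF complex_algebra_const])
    next
      case False
      then show ?thesis unfolding avg by (simp add: complex_algebra_const)
    qed
  qed simp
next
  case (add F G)
  then obtain M N where MN: "M > 0" "N > 0"
    "\<forall>N'\<ge>M. (\<lambda>x. (\<Sum>j<N'. F (turn (2 * pi * real j / real N') x)) / of_nat N') \<in> complex_algebra coord_basis_SO2"
    "\<forall>N'\<ge>N. (\<lambda>x. (\<Sum>j<N'. G (turn (2 * pi * real j / real N') x)) / of_nat N') \<in> complex_algebra coord_basis_SO2"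
    by blast
  show ?case
  proof (intro exI[of _ "max M N"] conjI allI impI)
    fix N' assume N': "max M N \<le> N'"
    show "(\<lambda>x. (\<Sum>j<N'. F (turn (2 * pi * real j / real N') x) + G (turn (2 * pi * real j / real N') x))
        / of_nat N') \<in> complex_algebra coord_basis_SO2"
      unfolding sum.distrib add_divide_distrib
      by (rule complex_algebra_add) (use MN N' in auto)
  qed (use MN in simp)
qed

lemma inv_rot_subset_generated: "inv_rot \<subseteq> generated_algebra coord_basis_SO2"
proof
  fix P assume P: "P \<in> inv_rot"
  then have poly: "real_polynomial_function P" and inv: "\<And>\<theta> x. P (turn \<theta> x) = P x"
    by (auto simp: inv_rot_def)
  obtain N where N: "N > 0"
    "(\<lambda>x. (\<Sum>j<N. complex_of_real (P (turn (2 * pi * real j / real N) x))) / of_nat N)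
      \<in> complex_algebra coord_basis_SO2"
    using average_word_span[OF polynomial_in_word_span[OF poly]] by blast
  then have "(\<lambda>x. complex_of_real (P x)) \<in> complex_algebra coord_basis_SO2"
    unfolding inv by simp
  then show "P \<in> generated_algebra coord_basis_SO2" by (simp add: complex_algebra_def)
qed

section \<open>Invariants of the full orthogonal group\<close>

text \<open>The action of the reflection \<open>refl_x\<close> in the complex coordinates.\<close>
definition conjugate :: "coords \<Rightarrow> coords" where
  "conjugate = (\<lambda>(a, b, c, d, z). (cnj a, cnj b, cnj c, cnj d, cnj z))"

definition inv_rot_refl :: "(coords \<Rightarrow> real) set" where
  "inv_rot_refl = {P \<in> inv_rot. \<forall>x. P (conjugate x) = P x}"

lemma letters_conj:
  "wone i (conjugate x) = cnj (wone i x)" "wthree (conjugate x) = cnj (wthree x)"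
  by (simp_all add: wone_def wthree_def conjugate_def split: prod.splits)

abbreviation re_algebra :: "(coords \<Rightarrow> real) set" where
  "re_algebra \<equiv> generated_algebra coord_basis_O2"

lemma Re_quad: "i < 4 \<Longrightarrow> j < 4 \<Longrightarrow> (\<lambda>x. Re (quad i j x)) \<in> re_algebra"
  by (intro generated_algebra.gen Re_quad_in_basis)

lemma Re_monomial: "m \<in> all_monomials \<Longrightarrow> (\<lambda>x. Re (m x)) \<in> re_algebra"
  unfolding coord_basis_O2_def by (intro generated_algebra.gen) blast

lemma Re_quart: "i < 4 \<Longrightarrow> j < 4 \<Longrightarrow> k < 4 \<Longrightarrow> (\<lambda>x. Re (quart i j k x)) \<in> re_algebra"
  by (intro Re_monomial quart_in_all_monomials)

lemma norm_three: "(\<lambda>x. Re (wthree x * cnj (wthree x))) \<in> re_algebra"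
  by (intro generated_algebra.gen Re_norm_three_in_basis)

text \<open>For plane vectors \<open>a, b, u\<close> Cramer's rule reads \<open>det a b * J u = \<langle>b, u\<rangle> * a - \<langle>a, u\<rangle> * b\<close>, up to
  the sign of the quarter turn \<open>J\<close>. Here \<open>Im (a * cnj b)\<close> is the determinant up to sign, \<open>Re (a * cnj u)\<close>
  the inner product, and \<open>Im (u * X)\<close> is \<open>Re (J u * X)\<close> for one choice of \<open>J\<close>. So one factor
  \<open>Im (a * cnj b)\<close> trades an imaginary part for real parts, whatever \<open>X\<close> is.\<close>
lemma Im_quad_Im_mult:
  assumes "i < 4" "j < 4" "k < 4" "\<And>l. l < 4 \<Longrightarrow> (\<lambda>x. Re (wone l x * X x)) \<in> re_algebra"
  shows "(\<lambda>x. Im (quad i j x) * Im (wone k x * X x)) \<in> re_algebra"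
proof -
  have cramer: "Im (a * cnj b) * Im (u * X) = Re (a * cnj u) * Re (b * X) - Re (b * cnj u) * Re (a * X)"
    for a b u X by (simp add: algebra_simps)
  have "(\<lambda>x. Im (quad i j x) * Im (wone k x * X x))
      = (\<lambda>x. Re (quad i k x) * Re (wone j x * X x) - Re (quad j k x) * Re (wone i x * X x))"
    unfolding quad_def cramer ..
  also have "\<dots> \<in> re_algebra"
    by (intro generated_algebra_diff generated_algebra.mult Re_quad assms)
  finally show ?thesis .
qed

lemma Im_quad_Im_quad:
  assumes "i < 4" "j < 4" "k < 4" "l < 4"
  shows "(\<lambda>x. Im (quad i j x) * Im (quad k l x)) \<in> re_algebra"
  unfolding quad_def[of k l]
  by (rule Im_quad_Im_mult) (use assms Re_quad in \<open>simp_all add: quad_def\<close>)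

lemma Im_quad_Im_quart:
  assumes "i < 4" "j < 4" "k < 4" "l < 4" "m < 4"
  shows "(\<lambda>x. Im (quad i j x) * Im (quart k l m x)) \<in> re_algebra"
  unfolding quart_def mult.assoc
  by (rule Im_quad_Im_mult) (use assms Re_quart in \<open>simp_all add: quart_def mult.assoc\<close>)

text \<open>For \<open>m = u * cnj d\<close> and \<open>m' = v * cnj d\<close> with cubic words \<open>u\<close> and \<open>v\<close>, the number
  \<open>Re (m * cnj m')\<close> is \<open>Re m * Re m' + Im m * Im m'\<close>. It is also \<open>d * cnj d\<close> times \<open>Re (u * cnj v)\<close>,
  and \<open>u * cnj v\<close> is a product of three factors of the form \<open>quad i j\<close>.\<close>
lemma Im_quart_Im_quart:
  assumes "i < 4" "j < 4" "k < 4" "l < 4" "m < 4" "n < 4"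
  shows "(\<lambda>x. Im (quart i j k x) * Im (quart l m n x)) \<in> re_algebra"
proof -
  have expand: "Re (p * q * r) = Re p * (Re q * Re r - Im q * Im r)
      - (Re q * (Im p * Im r) + Re r * (Im p * Im q))" for p q r
    by (simp add: algebra_simps)
  have "(\<lambda>x. Re (quad i l x * quad j m x * quad k n x)) \<in> re_algebra"
    unfolding expand
    by (intro generated_algebra_diff generated_algebra.add generated_algebra.mult Re_quad
        Im_quad_Im_quad assms)
  moreover have "Im (quart i j k x) * Im (quart l m n x)
      = Re (wthree x * cnj (wthree x)) * Re (quad i l x * quad j m x * quad k n x)
        - Re (quart i j k x) * Re (quart l m n x)" for x
  proof -
    have "Re (wthree x * cnj (wthree x)) * Re w = Re ((wthree x * cnj (wthree x)) * w)" for w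
      by simp
    also have "(wthree x * cnj (wthree x)) * (quad i l x * quad j m x * quad k n x)
        = quart i j k x * cnj (quart l m n x)"
      by (simp add: quad_def quart_def mult_ac)
    finally show ?thesis by simp
  qed
  ultimately show ?thesis
    by (simp only:) (intro generated_algebra_diff generated_algebra.mult Re_quart norm_three assms)
qed

lemma Im_monomial_Im_monomial:
  assumes "m \<in> all_monomials" "m' \<in> all_monomials"
  shows "(\<lambda>x. Im (m x) * Im (m' x)) \<in> re_algebra"
proof -
  have cases: "(\<exists>i j. m = quad i j \<and> i < 4 \<and> j < 4)
      \<or> (\<exists>i j k. m = quart i j k \<and> i < 4 \<and> j < 4 \<and> k < 4)" if "m \<in> all_monomials" for m
  proof -
    have "\<forall>(i, j)\<in>quad_index. i < 4 \<and> j < 4" by (simp add: quad_index_def)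
    moreover have "\<forall>(i, j, k)\<in>quart_index. i < 4 \<and> j < 4 \<and> k < 4" by (simp add: quart_index_def)
    ultimately show ?thesis using that unfolding all_monomials_eq by fast
  qed
  show ?thesis
    using cases[OF assms(1)] cases[OF assms(2)]
    by (elim disjE exE conjE)
      (simp_all add: Im_quad_Im_quad Im_quad_Im_quart Im_quart_Im_quart,
        simp add: Im_quad_Im_quart mult.commute[of "Im (quart _ _ _ _)"])
qed

text \<open>The odd part of the rotation invariants: the module over \<open>re_algebra\<close> that the imaginary parts
  generate.\<close>
inductive_set im_module :: "(coords \<Rightarrow> real) set" where
  zero: "(\<lambda>x. 0) \<in> im_module"
| gen: "f \<in> re_algebra \<Longrightarrow> m \<in> all_monomials \<Longrightarrow> (\<lambda>x. f x * Im (m x)) \<in> im_module"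
| add: "f \<in> im_module \<Longrightarrow> g \<in> im_module \<Longrightarrow> (\<lambda>x. f x + g x) \<in> im_module"

lemma im_module_scale:
  assumes "f \<in> re_algebra" "g \<in> im_module"
  shows "(\<lambda>x. f x * g x) \<in> im_module"
  using assms(2)
proof induction
  case (gen h m)
  then show ?case
    using im_module.gen[OF generated_algebra.mult[OF assms(1)]] by (simp add: mult.assoc)
next
  case (add g h)
  then show ?case using im_module.add[OF add.IH] by (simp add: distrib_left)
qed (simp add: im_module.zero)

lemma im_module_mult:
  assumes "f \<in> im_module" "g \<in> im_module"
  shows "(\<lambda>x. f x * g x) \<in> re_algebra"
proof -
  have Im: "(\<lambda>x. Im (m x) * g x) \<in> re_algebra" if m: "m \<in> all_monomials" for m
    using assms(2)
  proof induction
    case zero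
    then show ?case by (simp add: generated_algebra.const)
  next
    case (gen h m')
    then show ?case
      using generated_algebra.mult[OF gen(1) Im_monomial_Im_monomial[OF m gen(2)]]
      by (simp add: mult_ac)
  next
    case (add g h)
    then show ?case using generated_algebra.add[OF add.IH] by (simp add: distrib_left)
  qed
  show ?thesis
    using assms(1)
  proof induction
    case zero
    then show ?case by (simp add: generated_algebra.const)
  next
    case (gen f m)
    then show ?case using generated_algebra.mult[OF gen(1) Im[OF gen(2)]] by (simp add: mult.assoc)
  next
    case (add f h)
    then show ?case using generated_algebra.add[OF add.IH] by (simp add: distrib_right)
  qed
qed

text \<open>The sum of \<open>re_algebra\<close> and \<open>im_module\<close> is an algebra because the product of two elements of the
  module falls back into \<open>re_algebra\<close>.\<close>
lemma even_odd_decomposition: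
  assumes "f \<in> generated_algebra coord_basis_SO2"
  shows "\<exists>g\<in>re_algebra. \<exists>h\<in>im_module. f = (\<lambda>x. g x + h x)"
  using assms
proof induction
  case (const c)
  show ?case
    by (rule bexI[OF _ generated_algebra.const[of c]], rule bexI[OF _ im_module.zero]) simp
next
  case (gen p)
  then consider "p \<in> coord_basis_O2" | m where "m \<in> all_monomials" "p = (\<lambda>x. Im (m x))"
    unfolding coord_basis_SO2_def by blast
  then show ?case
  proof cases
    case 1
    then show ?thesis
      by (intro bexI[OF _ generated_algebra.gen] bexI[OF _ im_module.zero]) simp_all
  next
    case 2
    then show ?thesis
      using im_module.gen[OF generated_algebra.const[of 1] 2(1)]
      by (intro bexI[OF _ generated_algebra.const[of 0]] bexI[of _ p]) simp_all
  qed
next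
  case (add p q)
  then obtain g h g' h' where *: "g \<in> re_algebra" "h \<in> im_module" "g' \<in> re_algebra" "h' \<in> im_module"
    "p = (\<lambda>x. g x + h x)" "q = (\<lambda>x. g' x + h' x)" by blast
  show ?case
    by (rule bexI[OF _ generated_algebra.add[OF *(1,3)]], rule bexI[OF _ im_module.add[OF *(2,4)]])
      (simp add: *(5,6) add_ac)
next
  case (mult p q)
  then obtain g h g' h' where *: "g \<in> re_algebra" "h \<in> im_module" "g' \<in> re_algebra" "h' \<in> im_module"
    "p = (\<lambda>x. g x + h x)" "q = (\<lambda>x. g' x + h' x)" by blast
  have "(\<lambda>x. g x * g' x + h x * h' x) \<in> re_algebra"
    by (intro generated_algebra.add generated_algebra.mult im_module_mult *)
  moreover have "(\<lambda>x. g x * h' x + g' x * h x) \<in> im_module"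
    by (intro im_module.add im_module_scale *)
  ultimately show ?case
    by (intro bexI[where x = "\<lambda>x. g x * g' x + h x * h' x"]
        bexI[where x = "\<lambda>x. g x * h' x + g' x * h x"]) (simp add: *(5,6) algebra_simps)
qed

lemma monomial_conj:
  assumes "m \<in> square_norms \<union> all_monomials"
  shows "m (conjugate x) = cnj (m x)"
  using assms unfolding all_monomials_eq square_norms_eq
  by (auto simp: quad_def quart_def letters_conj)

lemma re_algebra_even: "f \<in> re_algebra \<Longrightarrow> f (conjugate x) = f x"
  by (induction rule: generated_algebra.induct)
    (auto simp: coord_basis_O2_def monomial_conj)

lemma im_module_odd: "f \<in> im_module \<Longrightarrow> f (conjugate x) = - f x"
  by (induction rule: im_module.induct) (simp_all add: re_algebra_even monomial_conj)

lemma inv_rot_refl_subset_generated: "inv_rot_refl \<subseteq> re_algebra"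
proof
  fix P assume P: "P \<in> inv_rot_refl"
  then have "P \<in> generated_algebra coord_basis_SO2"
    using inv_rot_subset_generated by (auto simp: inv_rot_refl_def)
  then obtain g h where gh: "g \<in> re_algebra" "h \<in> im_module" "P = (\<lambda>x. g x + h x)"
    using even_odd_decomposition by blast
  have "h x = 0" for x
  proof -
    have "P (conjugate x) = P x" using P unfolding inv_rot_refl_def by blast
    then show ?thesis by (simp add: gh(3) re_algebra_even[OF gh(1)] im_module_odd[OF gh(2)])
  qed
  then show "P \<in> re_algebra" using gh by simp
qed

section \<open>The generators are invariant\<close>

lemma monomial_turn:
  assumes "m \<in> square_norms \<union> all_monomials"
  shows "m (turn \<theta> x) = m x"
proof -
  have one: "cis \<theta> * u * cnj (cis \<theta> * v) = u * cnj v" for \<theta> u v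
    by (simp add: cis_cnj mult_ac cis_mult)
  have three: "cis \<theta> * u * (cis \<theta> * v) * (cis \<theta> * w) * cnj (cis (3 * \<theta>) * d) = u * v * w * cnj d" for u v w d
  proof -
    have "cis \<theta> * cis \<theta> * cis \<theta> * cis (- (3 * \<theta>)) = 1" by (simp add: cis_mult)
    then show ?thesis by (simp add: cis_cnj mult_ac)
  qed
  have "quad i j (turn \<theta> x) = quad i j x" "quart i j k (turn \<theta> x) = quart i j k x"
    "wthree (turn \<theta> x) * cnj (wthree (turn \<theta> x)) = wthree x * cnj (wthree x)" for i j k
    unfolding quad_def quart_def letters_turn by (rule one three)+
  then show ?thesis
    using assms unfolding all_monomials_eq square_norms_eq by fast
qed

lemma real_polynomial_letters:
  "real_polynomial_function (\<lambda>x. Re (wone i x))" "real_polynomial_function (\<lambda>x. Im (wone i x))"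
  "real_polynomial_function (\<lambda>x. Re (wthree x))" "real_polynomial_function (\<lambda>x. Im (wthree x))"
proof -
  have "linear (wone i)" "linear wthree"
    by (rule linearI; simp add: wone_def wthree_def split: prod.splits)+
  then have "bounded_linear (wone i)" "bounded_linear wthree"
    by (simp_all add: linear_conv_bounded_linear)
  then show "real_polynomial_function (\<lambda>x. Re (wone i x))" "real_polynomial_function (\<lambda>x. Im (wone i x))"
    "real_polynomial_function (\<lambda>x. Re (wthree x))" "real_polynomial_function (\<lambda>x. Im (wthree x))"
    by (simp_all add: real_polynomial_function.intros(1) bounded_linear_compose[OF bounded_linear_Re]
        bounded_linear_compose[OF bounded_linear_Im])
qed

lemma real_polynomial_complex_mult:
  assumes "real_polynomial_function (\<lambda>x. Re (F x))" "real_polynomial_function (\<lambda>x. Im (F x))"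
    "real_polynomial_function (\<lambda>x. Re (G x))" "real_polynomial_function (\<lambda>x. Im (G x))"
  shows "real_polynomial_function (\<lambda>x. Re (F x * G x)) \<and> real_polynomial_function (\<lambda>x. Im (F x * G x))"
  using assms by auto

lemma real_polynomial_monomial:
  assumes "m \<in> square_norms \<union> all_monomials"
  shows "real_polynomial_function (\<lambda>x. Re (m x)) \<and> real_polynomial_function (\<lambda>x. Im (m x))"
proof -
  have cnj: "real_polynomial_function (\<lambda>x. Re (cnj (F x)))" "real_polynomial_function (\<lambda>x. Im (cnj (F x)))"
    if "real_polynomial_function (\<lambda>x. Re (F x))" "real_polynomial_function (\<lambda>x. Im (F x))"
    for F :: "coords \<Rightarrow> complex"
    using that by auto
  note I = conjI real_polynomial_complex_mult[THEN conjunct1] real_polynomial_complex_mult[THEN conjunct2]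
    cnj real_polynomial_letters
  have "real_polynomial_function (\<lambda>x. Re (quad i j x)) \<and> real_polynomial_function (\<lambda>x. Im (quad i j x))" for i j
    unfolding quad_def by (intro I)
  moreover have "real_polynomial_function (\<lambda>x. Re (quart i j k x)) \<and> real_polynomial_function (\<lambda>x. Im (quart i j k x))" for i j k
    unfolding quart_def by (intro I)
  moreover have "real_polynomial_function (\<lambda>x. Re (wthree x * cnj (wthree x)))
      \<and> real_polynomial_function (\<lambda>x. Im (wthree x * cnj (wthree x)))"
    by (intro I)
  ultimately show ?thesis
    using assms unfolding all_monomials_eq square_norms_eq by auto
qed

lemma generated_eq_inv_rot: "generated_algebra coord_basis_SO2 = inv_rot"
proof (rule equalityI[OF _ inv_rot_subset_generated], rule subsetI)
  fix f assume "f \<in> generated_algebra coord_basis_SO2"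
  then show "f \<in> inv_rot"
  proof induction
    case (gen p)
    then obtain m where "m \<in> square_norms \<union> all_monomials" "p = (\<lambda>x. Re (m x)) \<or> p = (\<lambda>x. Im (m x))"
      unfolding coord_basis_SO2_def coord_basis_O2_def by blast
    then show ?case
      using real_polynomial_monomial[of m] monomial_turn[of m] by (auto simp: inv_rot_def)
  qed (auto simp: inv_rot_def)
qed

lemma generated_eq_inv_rot_refl: "re_algebra = inv_rot_refl"
proof (rule equalityI[OF _ inv_rot_refl_subset_generated], rule subsetI)
  fix f assume f: "f \<in> re_algebra"
  then have "f \<in> inv_rot"
    unfolding generated_eq_inv_rot[symmetric]
    by (rule generated_algebra_mono) (simp add: coord_basis_SO2_def)
  then show "f \<in> inv_rot_refl" using f by (simp add: inv_rot_refl_def re_algebra_even)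
qed

section \<open>Indecomposability of the generators\<close>

text \<open>Degree 2 for \<open>d\<close> puts the quartic monomials in degree 5, which is not a sum of two or more of the
  degrees 2, 4, 5 of the generators. In the usual grading their degree 4 is also reached by products
  of two quadratic invariants.\<close>
definition dilate :: "real \<Rightarrow> coords \<Rightarrow> coords" where
  "dilate s = (\<lambda>(a, b, c, d, z). (s * a, s * b, s * c, s ^ 2 * d, s * z))"

lemma Re_complex_of_real_mult: "Re (complex_of_real r * w) = r * Re w"
  and Im_complex_of_real_mult: "Im (complex_of_real r * w) = r * Im w"
  by simp_all

lemma letters_dilate:
  "wone i (dilate s x) = s * wone i x" "wthree (dilate s x) = s ^ 2 * wthree x"
  by (simp_all add: wone_def wthree_def dilate_def split: prod.splits)

text \<open>Along the curves \<open>s \<mapsto> dilate s x\<close> every element of the algebra is a polynomial in \<open>s\<close> whose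
  coefficients 1 and 3 vanish and whose constant term does not depend on the point. Therefore
  coefficients 2 and 5 obey the Leibniz rule at the origin, \<open>D (f * g) = f 0 * D g + g 0 * D f\<close>, and
  a linear functional \<open>\<Sum>i\<in>S. \<kappa> i * g (pts i)\<close> that kills the generators kills these
  coefficients on the whole algebra.\<close>
lemma linear_part_of_generated:
  fixes pts :: "'i \<Rightarrow> coords" and \<kappa> :: "'i \<Rightarrow> real"
  assumes hom: "\<And>g. g \<in> B \<Longrightarrow> \<exists>e\<in>{2, 4, 5}. \<forall>s x. g (dilate s x) = s ^ e * g x"
    and ann: "\<And>g. g \<in> B \<Longrightarrow> (\<Sum>i\<in>S. \<kappa> i * g (pts i)) = 0"
    and f: "f \<in> generated_algebra B"
  shows "\<exists>P c. (\<forall>i s. f (dilate s (pts i)) = poly (P i) s)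
    \<and> (\<forall>i. coeff (P i) 0 = c \<and> coeff (P i) 1 = 0 \<and> coeff (P i) 3 = 0)
    \<and> (\<Sum>i\<in>S. \<kappa> i * coeff (P i) 2) = 0 \<and> (\<Sum>i\<in>S. \<kappa> i * coeff (P i) 5) = 0"
  using f
proof induction
  case (const c)
  show ?case
    by (rule exI[of _ "\<lambda>i. [:c:]"], rule exI[of _ c]) (simp add: coeff_pCons split: nat.splits)
next
  case (gen g)
  then obtain e where e: "e \<in> {2, 4, 5}" "\<And>s x. g (dilate s x) = s ^ e * g x"
    using hom by blast
  show ?case
    by (rule exI[of _ "\<lambda>i. monom (g (pts i)) e"], rule exI[of _ 0])
      (use e(1) ann[OF gen] in \<open>auto simp: e(2) poly_monom mult.commute\<close>)
next
  case (add f g)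
  then obtain P c Q d where
    P: "\<And>i s. f (dilate s (pts i)) = poly (P i) s"
      "\<And>i. coeff (P i) 0 = c \<and> coeff (P i) 1 = 0 \<and> coeff (P i) 3 = 0"
      "(\<Sum>i\<in>S. \<kappa> i * coeff (P i) 2) = 0" "(\<Sum>i\<in>S. \<kappa> i * coeff (P i) 5) = 0" and
    Q: "\<And>i s. g (dilate s (pts i)) = poly (Q i) s"
      "\<And>i. coeff (Q i) 0 = d \<and> coeff (Q i) 1 = 0 \<and> coeff (Q i) 3 = 0"
      "(\<Sum>i\<in>S. \<kappa> i * coeff (Q i) 2) = 0" "(\<Sum>i\<in>S. \<kappa> i * coeff (Q i) 5) = 0"
    by blast
  show ?case
    by (rule exI[of _ "\<lambda>i. P i + Q i"], rule exI[of _ "c + d"])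
      (use P Q in \<open>simp add: distrib_left sum.distrib\<close>)
next
  case (mult f g)
  then obtain P c Q d where
    P: "\<And>i s. f (dilate s (pts i)) = poly (P i) s"
      "\<And>i. coeff (P i) 0 = c \<and> coeff (P i) 1 = 0 \<and> coeff (P i) 3 = 0"
      "(\<Sum>i\<in>S. \<kappa> i * coeff (P i) 2) = 0" "(\<Sum>i\<in>S. \<kappa> i * coeff (P i) 5) = 0" and
    Q: "\<And>i s. g (dilate s (pts i)) = poly (Q i) s"
      "\<And>i. coeff (Q i) 0 = d \<and> coeff (Q i) 1 = 0 \<and> coeff (Q i) 3 = 0"
      "(\<Sum>i\<in>S. \<kappa> i * coeff (Q i) 2) = 0" "(\<Sum>i\<in>S. \<kappa> i * coeff (Q i) 5) = 0"
    by blast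
  have atMost: "{..3} = {0, 1, 2, 3::nat}" "{..5} = {0, 1, 2, 3, 4, 5::nat}" "{..2} = {0, 1, 2::nat}"
    "{..1} = {0, 1::nat}"
    by auto
  have c2: "coeff (P i * Q i) 2 = c * coeff (Q i) 2 + d * coeff (P i) 2" for i
    using P(2)[of i] Q(2)[of i] by (simp add: coeff_mult atMost)
  have c5: "coeff (P i * Q i) 5 = c * coeff (Q i) 5 + d * coeff (P i) 5" for i
    using P(2)[of i] Q(2)[of i] by (simp add: coeff_mult atMost)
  have c0: "coeff (P i * Q i) 0 = c * d" "coeff (P i * Q i) 1 = 0" "coeff (P i * Q i) 3 = 0" for i
    using P(2)[of i] Q(2)[of i] unfolding coeff_mult atMost atMost_0 by simp_all
  have comb: "(\<Sum>i\<in>S. \<kappa> i * (c * u i + d * v i)) = c * (\<Sum>i\<in>S. \<kappa> i * u i) + d * (\<Sum>i\<in>S. \<kappa> i * v i)"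
    for u v by (simp add: sum_distrib_left sum.distrib algebra_simps)
  show ?case
    by (rule exI[of _ "\<lambda>i. P i * Q i"], rule exI[of _ "c * d"])
      (simp only: P(1) Q(1) poly_mult c0 c2 c5 comb P(3,4) Q(3,4), simp)
qed

lemma not_generated:
  fixes pts :: "'i \<Rightarrow> coords" and \<kappa> :: "'i \<Rightarrow> real"
  assumes hom: "\<And>g. g \<in> B \<Longrightarrow> \<exists>e\<in>{2, 4, 5}. \<forall>s x. g (dilate s x) = s ^ e * g x"
    and ann: "\<And>g. g \<in> B \<Longrightarrow> (\<Sum>i\<in>S. \<kappa> i * g (pts i)) = 0"
    and q: "e \<in> {2, 5}" "\<And>s x. q (dilate s x) = s ^ e * q x" "(\<Sum>i\<in>S. \<kappa> i * q (pts i)) \<noteq> 0"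
  shows "q \<notin> generated_algebra B"
proof
  assume "q \<in> generated_algebra B"
  have "\<exists>P c. (\<forall>i s. q (dilate s (pts i)) = poly (P i) s)
    \<and> (\<forall>i. coeff (P i) 0 = c \<and> coeff (P i) 1 = 0 \<and> coeff (P i) 3 = 0)
    \<and> (\<Sum>i\<in>S. \<kappa> i * coeff (P i) 2) = 0 \<and> (\<Sum>i\<in>S. \<kappa> i * coeff (P i) 5) = 0"
    by (rule linear_part_of_generated[OF _ _ \<open>q \<in> generated_algebra B\<close>]) (fact hom, fact ann)
  then obtain P where P: "\<And>i s. q (dilate s (pts i)) = poly (P i) s"
    "(\<Sum>i\<in>S. \<kappa> i * coeff (P i) 2) = 0" "(\<Sum>i\<in>S. \<kappa> i * coeff (P i) 5) = 0" by blast
  have "poly (P i) = poly (monom (q (pts i)) e)" for i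
    by (rule ext) (simp add: P(1)[symmetric] q(2) poly_monom)
  then have "P i = monom (q (pts i)) e" for i by (simp add: poly_eq_poly_eq_iff)
  then have "(\<Sum>i\<in>S. \<kappa> i * q (pts i)) = 0" using P(2,3) q(1) by auto
  then show False using q(3) by simp
qed

text \<open>The letters of weight one get the frequencies 1, 4, 16, 64 and \<open>d\<close> gets -256. The frequency of a
  quartic monomial is 256 plus three digits in base 4, which determines the multiset of letters; that
  of a quadratic one is a difference of two powers of 4, of absolute value below 256.\<close>
definition circle :: "real \<Rightarrow> coords" where
  "circle \<theta> = (cis \<theta>, cis (4 * \<theta>), cis (16 * \<theta>), cis (- 256 * \<theta>), cis (64 * \<theta>))"

text \<open>A relation, since a monomial is a mere function that does not carry its exponents along.\<close>
definition frequency_table :: "((coords \<Rightarrow> complex) \<times> int) set" where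
  "frequency_table = (\<lambda>(i, j). (quad i j, 4 ^ i - 4 ^ j)) ` quad_index
     \<union> (\<lambda>(i, j, k). (quart i j k, 256 + 4 ^ i + 4 ^ j + 4 ^ k)) ` quart_index"

lemma frequency_table_total: "m \<in> all_monomials \<Longrightarrow> \<exists>k. (m, k) \<in> frequency_table"
  unfolding all_monomials_eq frequency_table_def by force

lemma monomial_circle:
  assumes "(m, k) \<in> frequency_table"
  shows "m (circle \<theta>) = cis (of_int k * \<theta>)"
proof -
  have w: "wone i (circle \<theta>) = cis (4 ^ i * \<theta>)" if "i < 4" for i
    using that unfolding below_4 by (elim disjE) (simp_all add: wone_def circle_def)
  have w3: "cnj (wthree (circle \<theta>)) = cis (256 * \<theta>)"
    by (simp add: wthree_def circle_def cis_cnj)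
  have "\<forall>(i, j)\<in>quad_index. i < 4 \<and> j < 4" by (simp add: quad_index_def)
  moreover have "\<forall>(i, j, k)\<in>quart_index. i < 4 \<and> j < 4 \<and> k < 4" by (simp add: quart_index_def)
  ultimately consider
      i j where "m = quad i j" "k = 4 ^ i - 4 ^ j" "i < 4" "j < 4"
    | i j l where "m = quart i j l" "k = 256 + 4 ^ i + 4 ^ j + 4 ^ l" "i < 4" "j < 4" "l < 4"
    using assms unfolding frequency_table_def by fast
  then show ?thesis
  proof cases
    case 1
    then show ?thesis by (simp add: quad_def w cis_cnj cis_mult left_diff_distrib)
  next
    case 2
    then show ?thesis by (simp add: quart_def w w3 cis_mult algebra_simps)
  qed
qed

lemma frequency_bounds: "(m, k) \<in> frequency_table \<Longrightarrow> k \<noteq> 0 \<and> \<bar>k\<bar> < 500"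
  unfolding frequency_table_def quad_index_def quart_index_def by auto

text \<open>Opposite frequencies have to be excluded as well, because cosine and sine do not separate them.\<close>
lemma frequency_inj:
  assumes "(m, k) \<in> frequency_table" "(m', k') \<in> frequency_table" "k = k' \<or> k = - k'"
  shows "m = m'"
proof -
  define f2 :: "nat \<times> nat \<Rightarrow> int" where "f2 = (\<lambda>(i, j). 4 ^ i - 4 ^ j)"
  define f3 :: "nat \<times> nat \<times> nat \<Rightarrow> int" where "f3 = (\<lambda>(i, j, k). 256 + 4 ^ i + 4 ^ j + 4 ^ k)"
  have 2: "\<forall>u\<in>quad_index. \<forall>v\<in>quad_index. (f2 u = f2 v \<or> f2 u = - f2 v) \<longrightarrow> u = v"
    by (simp add: quad_index_def f2_def)
  have 3: "\<forall>u\<in>quart_index. \<forall>v\<in>quart_index. f3 u = f3 v \<longrightarrow> u = v"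
    by (simp add: quart_index_def f3_def)
  have small: "\<forall>u\<in>quad_index. \<bar>f2 u\<bar> < 256" by (simp add: quad_index_def f2_def)
  have large: "\<forall>v\<in>quart_index. f3 v > 256" by (simp add: quart_index_def f3_def)
  have table: "(\<exists>u\<in>quad_index. m = (\<lambda>(i, j). quad i j) u \<and> k = f2 u)
      \<or> (\<exists>u\<in>quart_index. m = (\<lambda>(i, j, k). quart i j k) u \<and> k = f3 u)"
    if "(m, k) \<in> frequency_table" for m k
    using that unfolding frequency_table_def f2_def f3_def by force
  from table[OF assms(1)] table[OF assms(2)] show ?thesis
  proof (elim disjE bexE)
    fix u v assume "u \<in> quad_index" "v \<in> quad_index" "m = (\<lambda>(i, j). quad i j) u \<and> k = f2 u"
      "m' = (\<lambda>(i, j). quad i j) v \<and> k' = f2 v"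
    then show ?thesis using 2 assms(3) by blast
  next
    fix u v assume uv: "u \<in> quad_index" "v \<in> quart_index" "m = (\<lambda>(i, j). quad i j) u \<and> k = f2 u"
      "m' = (\<lambda>(i, j, k). quart i j k) v \<and> k' = f3 v"
    then have "\<bar>k\<bar> < 256" "k' > 256" using small large by auto
    then show ?thesis using assms(3) by linarith
  next
    fix u v assume uv: "u \<in> quart_index" "v \<in> quad_index" "m = (\<lambda>(i, j, k). quart i j k) u \<and> k = f3 u"
      "m' = (\<lambda>(i, j). quad i j) v \<and> k' = f2 v"
    then have "\<bar>k'\<bar> < 256" "k > 256" using small large by auto
    then show ?thesis using assms(3) by linarith
  next
    fix u v assume uv: "u \<in> quart_index" "v \<in> quart_index" "m = (\<lambda>(i, j, k). quart i j k) u \<and> k = f3 u"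
      "m' = (\<lambda>(i, j, k). quart i j k) v \<and> k' = f3 v"
    then have "k > 256" "k' > 256" using large by auto
    then have "f3 u = f3 v" using assms(3) uv by linarith
    then show ?thesis using 3 uv by blast
  qed
qed

text \<open>All frequencies are below 500 in absolute value, so their sums and differences are below 1000,
  and 1000 nodes give exact orthogonality.\<close>
definition node :: "nat \<Rightarrow> real" where
  "node j = 2 * pi * real j / 1000"

lemma sum_cos_sin_nodes:
  assumes "\<bar>k\<bar> < 1000"
  shows "(\<Sum>j<1000. cos (of_int k * node j)) = (if k = 0 then 1000 else 0)"
    "(\<Sum>j<1000. sin (of_int k * node j)) = 0"
proof -
  have "(\<Sum>j<1000. cis (of_int k * node j)) = (if k = 0 then 1000 else 0)"
    using sum_cis_roots[of k 1000] assms by (simp add: node_def)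
  then have "Re (\<Sum>j<1000. cis (of_int k * node j)) = Re (if k = 0 then 1000 else 0)"
    "Im (\<Sum>j<1000. cis (of_int k * node j)) = Im (if k = 0 then 1000 else 0)" by simp_all
  then show "(\<Sum>j<1000. cos (of_int k * node j)) = (if k = 0 then 1000 else 0)"
    "(\<Sum>j<1000. sin (of_int k * node j)) = 0" by (auto split: if_splits)
qed

lemma orthogonality:
  fixes k l :: int
  assumes "\<bar>k\<bar> < 500" "\<bar>l\<bar> < 500"
  shows "(\<Sum>j<1000. cos (of_int k * node j) * sin (of_int l * node j)) = 0"
    and "(\<Sum>j<1000. sin (of_int k * node j) * cos (of_int l * node j)) = 0"
    and "k \<noteq> l \<Longrightarrow> k \<noteq> - l \<Longrightarrow> (\<Sum>j<1000. cos (of_int k * node j) * cos (of_int l * node j)) = 0"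
    and "k \<noteq> l \<Longrightarrow> k \<noteq> - l \<Longrightarrow> (\<Sum>j<1000. sin (of_int k * node j) * sin (of_int l * node j)) = 0"
    and "k \<noteq> 0 \<Longrightarrow> (\<Sum>j<1000. cos (of_int k * node j) * cos (of_int k * node j)) = 500"
    and "k \<noteq> 0 \<Longrightarrow> (\<Sum>j<1000. sin (of_int k * node j) * sin (of_int k * node j)) = 500"
proof -
  have b: "\<bar>k + l\<bar> < 1000" "\<bar>k - l\<bar> < 1000" "\<bar>k + k\<bar> < 1000" "\<bar>k - k\<bar> < 1000" using assms by linarith+
  have cc: "(\<Sum>j<1000. cos (of_int k * node j) * cos (of_int l * node j))
    = ((\<Sum>j<1000. cos (of_int (k - l) * node j)) + (\<Sum>j<1000. cos (of_int (k + l) * node j))) / 2" for k l :: int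
    unfolding sum.distrib[symmetric] sum_divide_distrib
    by (simp add: cos_times_cos left_diff_distrib distrib_right)
  have ss: "(\<Sum>j<1000. sin (of_int k * node j) * sin (of_int l * node j))
    = ((\<Sum>j<1000. cos (of_int (k - l) * node j)) - (\<Sum>j<1000. cos (of_int (k + l) * node j))) / 2" for k l :: int
    unfolding sum_subtractf[symmetric] sum_divide_distrib
    by (simp add: sin_times_sin left_diff_distrib distrib_right)
  have sc: "(\<Sum>j<1000. sin (of_int k * node j) * cos (of_int l * node j))
    = ((\<Sum>j<1000. sin (of_int (k + l) * node j)) + (\<Sum>j<1000. sin (of_int (k - l) * node j))) / 2" for k l :: int
    unfolding sum.distrib[symmetric] sum_divide_distrib
    by (simp add: sin_times_cos left_diff_distrib distrib_right)
  have cs: "(\<Sum>j<1000. cos (of_int k * node j) * sin (of_int l * node j))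
    = ((\<Sum>j<1000. sin (of_int (k + l) * node j)) - (\<Sum>j<1000. sin (of_int (k - l) * node j))) / 2" for k l :: int
    unfolding sum_subtractf[symmetric] sum_divide_distrib
    by (simp add: cos_times_sin left_diff_distrib distrib_right)
  show "(\<Sum>j<1000. cos (of_int k * node j) * sin (of_int l * node j)) = 0"
    "(\<Sum>j<1000. sin (of_int k * node j) * cos (of_int l * node j)) = 0"
    unfolding cs sc sum_cos_sin_nodes[OF b(1)] sum_cos_sin_nodes[OF b(2)] by simp_all
  show "(\<Sum>j<1000. cos (of_int k * node j) * cos (of_int l * node j)) = 0"
    "(\<Sum>j<1000. sin (of_int k * node j) * sin (of_int l * node j)) = 0" if "k \<noteq> l" "k \<noteq> - l"
    unfolding cc ss sum_cos_sin_nodes[OF b(1)] sum_cos_sin_nodes[OF b(2)] using that by auto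
  show "(\<Sum>j<1000. cos (of_int k * node j) * cos (of_int k * node j)) = 500"
    "(\<Sum>j<1000. sin (of_int k * node j) * sin (of_int k * node j)) = 500" if "k \<noteq> 0"
    unfolding cc ss sum_cos_sin_nodes[OF b(3)] sum_cos_sin_nodes[OF b(4)] using that by auto
qed

lemma coord_basis_SO2_cases:
  assumes "g \<in> coord_basis_SO2"
  obtains n where "n \<in> square_norms" "g = (\<lambda>x. Re (n x))"
    | m where "m \<in> all_monomials" "g = (\<lambda>x. Re (m x))"
    | m where "m \<in> all_monomials" "g = (\<lambda>x. Im (m x))"
  using assms unfolding coord_basis_SO2_def coord_basis_O2_def by blast

lemma monomial_dilate:
  assumes "m \<in> all_monomials"
  shows "\<exists>e\<in>{2, 5}. \<forall>s x. m (dilate s x) = of_real (s ^ e) * m x"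
proof -
  have "quad i j (dilate s x) = of_real (s ^ 2) * quad i j x" for i j s x
    by (simp add: quad_def letters_dilate power2_eq_square)
  moreover have "quart i j k (dilate s x) = of_real (s ^ 5) * quart i j k x" for i j k s x
    by (simp add: quart_def letters_dilate eval_nat_numeral)
  ultimately show ?thesis using assms unfolding all_monomials_eq by fast
qed

lemma norm_dilate:
  assumes "n \<in> square_norms"
  shows "\<exists>e\<in>{2, 4}. \<forall>s x. n (dilate s x) = of_real (s ^ e) * n x"
proof -
  have "quad i j (dilate s x) = of_real (s ^ 2) * quad i j x" for i j s x
    by (simp add: quad_def letters_dilate power2_eq_square)
  moreover have "wthree (dilate s x) * cnj (wthree (dilate s x)) = of_real (s ^ 4) * (wthree x * cnj (wthree x))" for s x
    by (simp add: letters_dilate eval_nat_numeral)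
  ultimately show ?thesis using assms unfolding square_norms_eq by fast
qed

lemma basis_dilate:
  assumes "g \<in> coord_basis_SO2"
  shows "\<exists>e\<in>{2, 4, 5}. \<forall>s x. g (dilate s x) = s ^ e * g x"
  using assms
proof (cases rule: coord_basis_SO2_cases)
  case (1 n)
  then show ?thesis using norm_dilate[OF 1(1)] by (metis Re_complex_of_real_mult Im_complex_of_real_mult insert_iff)
next
  case (2 m)
  then show ?thesis using monomial_dilate[OF 2(1)] by (metis Re_complex_of_real_mult Im_complex_of_real_mult insert_iff)
next
  case (3 m)
  then show ?thesis using monomial_dilate[OF 3(1)] by (metis Re_complex_of_real_mult Im_complex_of_real_mult insert_iff)
qed

lemma norm_circle: "n \<in> square_norms \<Longrightarrow> n (circle \<theta>) = 1"
  unfolding square_norms_def circle_def by (auto simp: cis_cnj cis_mult)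

text \<open>The functional is the discrete cosine coefficient at the frequency of \<open>m\<close>. It kills the square
  norms, which are 1 on the circle, all imaginary parts, which are sines, and the real parts of the
  other monomials, which have other frequencies.\<close>
lemma Re_monomial_indecomposable:
  assumes m: "m \<in> all_monomials"
  shows "(\<lambda>x. Re (m x)) \<notin> generated_algebra (coord_basis_SO2 - {\<lambda>x. Re (m x)})"
proof -
  obtain k where k: "(m, k) \<in> frequency_table" using frequency_table_total[OF m] by blast
  note kb = frequency_bounds[OF k]
  obtain e where e: "e \<in> {2, 5}" "\<And>s x. m (dilate s x) = of_real (s ^ e) * m x"
    using monomial_dilate[OF m] by blast
  show ?thesis
  proof (rule not_generated[where pts = "\<lambda>j. circle (node j)" and \<kappa> = "\<lambda>j. cos (of_int k * node j)"
        and S = "{..<1000}" and e = e])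
    show "e \<in> {2, 5}" by (rule e)
    show "Re (m (dilate s x)) = s ^ e * Re (m x)" for s x
      unfolding e(2) by (simp del: of_real_power)
    show "(\<Sum>j<1000. cos (of_int k * node j) * Re (m (circle (node j)))) \<noteq> 0"
      using orthogonality(5)[of k 0] kb by (simp add: monomial_circle[OF k])
    fix g assume g: "g \<in> coord_basis_SO2 - {\<lambda>x. Re (m x)}"
    then show "\<exists>e\<in>{2, 4, 5}. \<forall>s x. g (dilate s x) = s ^ e * g x" using basis_dilate by blast
    from g have "g \<in> coord_basis_SO2" by blast
    then show "(\<Sum>j<1000. cos (of_int k * node j) * g (circle (node j))) = 0"
    proof (cases rule: coord_basis_SO2_cases)
      case (1 n)
      then show ?thesis using sum_cos_sin_nodes(1)[of k] kb by (simp add: norm_circle)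
    next
      case (2 m')
      obtain k' where k': "(m', k') \<in> frequency_table" using frequency_table_total[OF 2(1)] by blast
      have "m' \<noteq> m" using g 2 by auto
      then have "k \<noteq> k'" "k \<noteq> - k'" using frequency_inj[OF k k'] by auto
      then show ?thesis
        using orthogonality(3)[of k k'] kb frequency_bounds[OF k'] by (simp add: 2 monomial_circle[OF k'])
    next
      case (3 m')
      obtain k' where k': "(m', k') \<in> frequency_table" using frequency_table_total[OF 3(1)] by blast
      show ?thesis
        using orthogonality(1)[of k k'] kb frequency_bounds[OF k'] by (simp add: 3 monomial_circle[OF k'])
    qed
  qed
qed

text \<open>The same argument with the discrete sine coefficient.\<close>
lemma Im_monomial_indecomposable:
  assumes m: "m \<in> all_monomials"
  shows "(\<lambda>x. Im (m x)) \<notin> generated_algebra (coord_basis_SO2 - {\<lambda>x. Im (m x)})"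
proof -
  obtain k where k: "(m, k) \<in> frequency_table" using frequency_table_total[OF m] by blast
  note kb = frequency_bounds[OF k]
  obtain e where e: "e \<in> {2, 5}" "\<And>s x. m (dilate s x) = of_real (s ^ e) * m x"
    using monomial_dilate[OF m] by blast
  show ?thesis
  proof (rule not_generated[where pts = "\<lambda>j. circle (node j)" and \<kappa> = "\<lambda>j. sin (of_int k * node j)"
        and S = "{..<1000}" and e = e])
    show "e \<in> {2, 5}" by (rule e)
    show "Im (m (dilate s x)) = s ^ e * Im (m x)" for s x
      unfolding e(2) by (simp del: of_real_power)
    show "(\<Sum>j<1000. sin (of_int k * node j) * Im (m (circle (node j)))) \<noteq> 0"
      using orthogonality(6)[of k 0] kb by (simp add: monomial_circle[OF k])
    fix g assume g: "g \<in> coord_basis_SO2 - {\<lambda>x. Im (m x)}"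
    then show "\<exists>e\<in>{2, 4, 5}. \<forall>s x. g (dilate s x) = s ^ e * g x" using basis_dilate by blast
    from g have "g \<in> coord_basis_SO2" by blast
    then show "(\<Sum>j<1000. sin (of_int k * node j) * g (circle (node j))) = 0"
    proof (cases rule: coord_basis_SO2_cases)
      case (1 n)
      then show ?thesis using sum_cos_sin_nodes(2)[of k] kb by (simp add: norm_circle)
    next
      case (2 m')
      obtain k' where k': "(m', k') \<in> frequency_table" using frequency_table_total[OF 2(1)] by blast
      show ?thesis
        using orthogonality(2)[of k k'] kb frequency_bounds[OF k'] by (simp add: 2 monomial_circle[OF k'])
    next
      case (3 m')
      obtain k' where k': "(m', k') \<in> frequency_table" using frequency_table_total[OF 3(1)] by blast
      have "m' \<noteq> m" using g 3 by auto
      then have "k \<noteq> k'" "k \<noteq> - k'" using frequency_inj[OF k k'] by auto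
      then show ?thesis
        using orthogonality(4)[of k k'] kb frequency_bounds[OF k'] by (simp add: 3 monomial_circle[OF k'])
    qed
  qed
qed

lemma generated_agree:
  assumes "\<And>g. g \<in> B \<Longrightarrow> g x = g y" "f \<in> generated_algebra B"
  shows "f x = f y"
  using assms(2) by induction (simp_all add: assms(1))

text \<open>On a coordinate axis only one letter is nonzero, so its square norm is the only generator that
  is not zero there, and the algebra of the others is constant on the axis.\<close>
lemma norm_indecomposable:
  assumes n: "n \<in> square_norms"
  shows "(\<lambda>x. Re (n x)) \<notin> generated_algebra (coord_basis_SO2 - {\<lambda>x. Re (n x)})"
proof -
  define axes :: "coords set" where
    "axes = {(1,0,0,0,0), (0,1,0,0,0), (0,0,1,0,0), (0,0,0,1,0), (0,0,0,0,1)}"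
  have mono: "m x = 0 \<and> m 0 = 0" if "m \<in> all_monomials" "x \<in> axes" for m x
  proof -
    have "\<forall>(i, j)\<in>quad_index. i < 4 \<and> j < 4 \<and> i \<noteq> j" by (simp add: quad_index_def)
    moreover have "quad i j x = 0 \<and> quad i j 0 = 0" if "i < 4" "j < 4" "i \<noteq> j" for i j
      using that \<open>x \<in> axes\<close> unfolding axes_def below_4
      by (elim disjE insertE emptyE) (simp_all add: quad_def wone_def zero_prod_def)
    moreover have "quart i j k x = 0 \<and> quart i j k 0 = 0" for i j k
      using \<open>x \<in> axes\<close> unfolding axes_def
      by (elim insertE emptyE) (simp_all add: quart_def wone_def wthree_def zero_prod_def)
    ultimately show ?thesis using that(1) unfolding all_monomials_eq by fast
  qed
  have "\<exists>x\<in>axes. n x = 1 \<and> n 0 = 0 \<and> (\<forall>n'\<in>square_norms. n' \<noteq> n \<longrightarrow> n' x = 0 \<and> n' 0 = 0)"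
    using n unfolding square_norms_def axes_def
    by (elim insertE emptyE) (simp_all add: zero_prod_def)
  then obtain x where x: "x \<in> axes" "n x = 1" "n 0 = 0"
    "\<And>n'. n' \<in> square_norms \<Longrightarrow> n' \<noteq> n \<Longrightarrow> n' x = 0 \<and> n' 0 = 0" by blast
  have agree: "g x = g 0" if g: "g \<in> coord_basis_SO2 - {\<lambda>x. Re (n x)}" for g
  proof -
    from g have "g \<in> coord_basis_SO2" by blast
    then show ?thesis
    proof (cases rule: coord_basis_SO2_cases)
      case (1 n')
      then have "n' \<noteq> n" using g by auto
      then have "n' x = 0" "n' 0 = 0" using x(4) 1 by blast+
      then show ?thesis by (simp only: 1)
    next
      case (2 m)
      then show ?thesis using mono[OF 2(1) x(1)] by (simp only: 2)
    next
      case (3 m)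
      then show ?thesis using mono[OF 3(1) x(1)] by (simp only: 3)
    qed
  qed
  show ?thesis
  proof
    assume "(\<lambda>x. Re (n x)) \<in> generated_algebra (coord_basis_SO2 - {\<lambda>x. Re (n x)})"
    then have "Re (n x) = Re (n 0)"
      by (rule generated_agree[rotated, where f = "\<lambda>x. Re (n x)" and x = x and y = 0]) (rule agree)
    then show False using x(2,3) by simp
  qed
qed

lemma basis_indecomposable:
  assumes "q \<in> coord_basis_SO2"
  shows "q \<notin> generated_algebra (coord_basis_SO2 - {q})"
  using assms
  by (cases rule: coord_basis_SO2_cases)
    (simp_all add: norm_indecomposable Re_monomial_indecomposable Im_monomial_indecomposable)

lemma finite_monomials: "finite square_norms" "finite all_monomials"
  by (simp_all add: square_norms_def all_monomials_eq quad_index_def quart_index_def)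

lemma basis_homogeneous:
  assumes "g \<in> coord_basis_SO2"
  shows "homogeneous g"
proof -
  have one: "wone i (t *\<^sub>R x) = t *\<^sub>R wone i x" and three: "wthree (t *\<^sub>R x) = t *\<^sub>R wthree x" for i t x
    by (simp_all add: wone_def wthree_def split: prod.splits)
  have 2: "\<exists>d. \<forall>t x. quad i j (t *\<^sub>R x) = of_real (t ^ d) * quad i j x" for i j
    by (rule exI[of _ 2]) (simp add: quad_def one scaleR_conv_of_real power2_eq_square)
  have 3: "\<exists>d. \<forall>t x. quart i j k (t *\<^sub>R x) = of_real (t ^ d) * quart i j k x" for i j k
    by (rule exI[of _ 4]) (simp add: quart_def one three scaleR_conv_of_real eval_nat_numeral)
  have 4: "\<exists>d. \<forall>t x. wthree (t *\<^sub>R x) * cnj (wthree (t *\<^sub>R x)) = of_real (t ^ d) * (wthree x * cnj (wthree x))"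
    by (rule exI[of _ 2]) (simp add: three scaleR_conv_of_real power2_eq_square)
  obtain m where m: "m \<in> square_norms \<union> all_monomials" "g = (\<lambda>x. Re (m x)) \<or> g = (\<lambda>x. Im (m x))"
    using assms by (cases rule: coord_basis_SO2_cases) blast+
  have "\<exists>d. \<forall>t x. m (t *\<^sub>R x) = of_real (t ^ d) * m x"
    using m(1) 2 3 4 unfolding all_monomials_eq square_norms_eq by fast
  then obtain d where d: "\<And>t x. m (t *\<^sub>R x) = of_real (t ^ d) * m x" by blast
  show ?thesis unfolding homogeneous_def
    using m(2)
  proof
    assume "g = (\<lambda>x. Re (m x))"
    then have "g (t *\<^sub>R x) = t ^ d * g x" for t x by (simp only: d Re_complex_of_real_mult)
    then show "\<exists>d. \<forall>t x. g (t *\<^sub>R x) = t ^ d * g x" by blast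
  next
    assume "g = (\<lambda>x. Im (m x))"
    then have "g (t *\<^sub>R x) = t ^ d * g x" for t x by (simp only: d Im_complex_of_real_mult)
    then show "\<exists>d. \<forall>t x. g (t *\<^sub>R x) = t ^ d * g x" by blast
  qed
qed

lemma minimal_basis_SO2: "minimal_integrity_basis inv_rot coord_basis_SO2"
proof (rule minimal_integrity_basisI)
  show "finite coord_basis_SO2"
    by (simp add: coord_basis_SO2_def coord_basis_O2_def finite_monomials)
qed (simp_all add: basis_homogeneous basis_indecomposable generated_eq_inv_rot)

lemma minimal_basis_O2: "minimal_integrity_basis inv_rot_refl coord_basis_O2"
proof (rule minimal_integrity_basisI)
  have sub: "coord_basis_O2 \<subseteq> coord_basis_SO2" by (simp add: coord_basis_SO2_def)
  show "finite coord_basis_O2"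
    by (simp add: coord_basis_O2_def finite_monomials)
  show "homogeneous p" if "p \<in> coord_basis_O2" for p using basis_homogeneous that sub by blast
  show "q \<notin> generated_algebra (coord_basis_O2 - {q})" if "q \<in> coord_basis_O2" for q
  proof
    assume "q \<in> generated_algebra (coord_basis_O2 - {q})"
    then have "q \<in> generated_algebra (coord_basis_SO2 - {q})"
      by (rule generated_algebra_mono) (use sub in blast)
    then show False using basis_indecomposable that sub by blast
  qed
qed (rule generated_eq_inv_rot_refl)

section \<open>Counting the generators\<close>

lemma finite_coord_basis: "finite coord_basis_SO2" "finite coord_basis_O2"
  by (simp_all add: coord_basis_SO2_def coord_basis_O2_def finite_monomials)

text \<open>A point at which the 57 generators take 57 distinct nonzero values, so that the cardinalities
  reduce to counting integers.\<close>
definition sample :: coords where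
  "sample = (Complex (-1) 5, Complex 5 2, Complex (-4) 3, -1, Complex 5 4)"

lemma wone_sample:
  "wone 0 sample = Complex (-1) 5" "wone (Suc 0) sample = Complex 5 2" "wone 1 sample = Complex 5 2"
  "wone 2 sample = Complex (-4) 3"
  "wone 3 sample = Complex 5 4" "wthree sample = Complex (-1) 0"
  by (simp_all add: wone_def wthree_def sample_def complex_eq_iff)

lemmas sample_simps = wone_sample quad_def quart_def complex_cnj complex_mult

definition invariant_norms :: "(coords \<Rightarrow> complex) set" where
  "invariant_norms = {quad 0 0, quad 1 1, quad 2 2, (\<lambda>x. wthree x * cnj (wthree x))}"

definition covariant_monomials :: "(coords \<Rightarrow> complex) set" where
  "covariant_monomials = {quad 3 0, quad 3 1, quad 3 2, quart 0 0 3, quart 1 1 3, quart 2 2 3,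
     quart 0 1 3, quart 0 2 3, quart 1 2 3, quart 0 3 3, quart 1 3 3, quart 2 3 3, quart 3 3 3}"

lemma covariant_monomials_eq: "covariant_monomials = monomials 1 \<union> monomials 2 \<union> monomials 3"
  unfolding monomials_1 monomials_2 monomials_3 covariant_monomials_def Un_insert_left Un_empty_left
  by (rule refl)

lemma square_norms_split: "square_norms = insert (quad 3 3) invariant_norms"
  unfolding square_norms_eq invariant_norms_def
  by (rule equalityI) (simp_all only: insert_subset insert_iff empty_subsetI simp_thms)

lemma all_monomials_split: "all_monomials = monomials 0 \<union> covariant_monomials"
  unfolding UN_monomials covariant_monomials_eq by (simp only: Un_assoc)

lemma Re_sample_norms:
  "(\<lambda>m. Re (m sample)) ` invariant_norms = {26, 29, 25, 1}"
  "Re (quad 3 3 sample) = 41"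
  by (simp_all add: invariant_norms_def sample_simps)

lemma sample_monomials_0:
  "(\<lambda>m. Re (m sample)) ` monomials 0 = {5, 19, -14, -74, -65, -44, 121, -83, 144, -126, 100, -113, 9}"
  "(\<lambda>m. Im (m sample)) ` monomials 0 = {27, -17, -23, 110, -142, -117, -85, 106, 17, 32, 98, -59, 137}"
  by (simp_all add: monomials_0 sample_simps)

lemma sample_covariant_monomials:
  "(\<lambda>m. Re (m sample)) ` covariant_monomials = {15, 33, -8, 80, -25, -131, 167, -37, 158, 209, 35, 156, 115}"
  "(\<lambda>m. Im (m sample)) ` covariant_monomials = {-29, 10, -31, 146, -184, 92, -55, 159, 69, -5, -218, 133, -236}"
  by (simp_all add: covariant_monomials_def sample_simps)

lemma card_le_generators:
  "card invariant_norms \<le> 4" "card (monomials 0) \<le> 13" "card covariant_monomials \<le> 13"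
  "finite invariant_norms" "finite (monomials 0)" "finite covariant_monomials"
  by (simp_all add: invariant_norms_def monomials_0 covariant_monomials_def card_insert_le_m1)

lemma card_eqI:
  assumes "finite A" "card A \<le> n" "card (f ` A) = n"
  shows "card A = n"
  using card_image_le[OF assms(1), of f] assms(2,3) by simp

definition coord_invariants_O2 :: "(coords \<Rightarrow> real) set" where
  "coord_invariants_O2 = (\<lambda>m x. Re (m x)) ` (invariant_norms \<union> monomials 0)"

definition coord_invariants_SO2 :: "(coords \<Rightarrow> real) set" where
  "coord_invariants_SO2 = coord_invariants_O2 \<union> (\<lambda>m x. Im (m x)) ` monomials 0"

lemma card_basis:
  "card all_monomials = 26" "card coord_basis_SO2 = 57" "card coord_basis_O2 = 31"
  "card coord_invariants_SO2 = 30" "card coord_invariants_O2 = 17"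
proof -
  have le: "card ((\<lambda>m x. Re (m x)) ` M) \<le> card M" "card ((\<lambda>m x. Im (m x)) ` M) \<le> card M"
    if "finite M" for M :: "(coords \<Rightarrow> complex) set"
    using that by (simp_all add: card_image_le)
  have val: "(\<lambda>g. g sample) ` (\<lambda>m x. Re (m x)) ` M = (\<lambda>m. Re (m sample)) ` M"
    "(\<lambda>g. g sample) ` (\<lambda>m x. Im (m x)) ` M = (\<lambda>m. Im (m sample)) ` M"
    for M :: "(coords \<Rightarrow> complex) set"
    by (simp_all add: image_image)
  note vals = val image_Un image_insert Re_sample_norms sample_monomials_0 sample_covariant_monomials
    square_norms_split all_monomials_split
  have fin: "finite square_norms" "finite all_monomials" by (rule finite_monomials)+
  have norms: "card square_norms \<le> 5"
    unfolding square_norms_split using card_le_generators by (simp add: card_insert_if)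
  have le26: "card all_monomials \<le> 26"
    unfolding all_monomials_split using card_Un_le[of "monomials 0" covariant_monomials] card_le_generators
    by linarith
  show "card all_monomials = 26"
    by (rule card_eqI[OF fin(2) le26, of "\<lambda>m. Re (m sample)"]) (simp add: vals)
  have le31: "card coord_basis_O2 \<le> 31"
    unfolding coord_basis_O2_def using le(1)[of "square_norms \<union> all_monomials"]
      card_Un_le[of square_norms all_monomials] fin norms le26 by simp
  show "card coord_basis_O2 = 31"
    by (rule card_eqI[OF finite_coord_basis(2) le31, of "\<lambda>g. g sample"]) (simp add: coord_basis_O2_def vals)
  have le57: "card coord_basis_SO2 \<le> 57"
    unfolding coord_basis_SO2_def
    using card_Un_le[of coord_basis_O2 "(\<lambda>m x. Im (m x)) ` all_monomials"] le(2)[OF fin(2)] le26 le31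
    by linarith
  show "card coord_basis_SO2 = 57"
    by (rule card_eqI[OF finite_coord_basis(1) le57, of "\<lambda>g. g sample"])
      (simp add: coord_basis_SO2_def coord_basis_O2_def vals)
  have le17: "card coord_invariants_O2 \<le> 17"
    unfolding coord_invariants_O2_def using le(1)[of "invariant_norms \<union> monomials 0"]
      card_Un_le[of invariant_norms "monomials 0"] card_le_generators by simp
  have fin17: "finite coord_invariants_O2"
    by (simp add: coord_invariants_O2_def card_le_generators)
  show "card coord_invariants_O2 = 17"
    by (rule card_eqI[OF fin17 le17, of "\<lambda>g. g sample"]) (simp add: coord_invariants_O2_def vals)
  have le30: "card coord_invariants_SO2 \<le> 30"
    unfolding coord_invariants_SO2_def
    using card_Un_le[of coord_invariants_O2 "(\<lambda>m x. Im (m x)) ` monomials 0"] le(2)[of "monomials 0"]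
      card_le_generators le17
    by linarith
  have fin30: "finite coord_invariants_SO2"
    by (simp add: coord_invariants_SO2_def fin17 card_le_generators)
  show "card coord_invariants_SO2 = 30"
    by (rule card_eqI[OF fin30 le30, of "\<lambda>g. g sample"])
      (simp add: coord_invariants_SO2_def coord_invariants_O2_def vals)
qed

section \<open>Orders of the generators\<close>

definition zscale :: "real \<Rightarrow> coords \<Rightarrow> coords" where
  "zscale t = (\<lambda>(a, b, c, d, z). (a, b, c, d, t * z))"

lemma coords_scale: "coords \<phi> (v, t *\<^sub>R x) = zscale t (coords \<phi> (v, x))"
proof -
  have "Complex (t * p) (t * q) = t * Complex p q" for p q by (simp add: complex_eq_iff)
  then show ?thesis by (simp add: coords_def zscale_def split: prod.splits)
qed

text \<open>If \<open>g\<close> is homogeneous of degree \<open>k\<close> in \<open>z\<close>, every restriction to a line through 0 in the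
  vector variable is a multiple of \<open>t ^ k\<close>, and one of them is nonzero.\<close>
lemma cov_order_pullback:
  assumes "surj (coords \<phi>)" "\<And>t x. g (zscale t x) = t ^ k * g x" "g y \<noteq> 0"
  shows "cov_order (g \<circ> coords \<phi>) = k"
proof -
  let ?p = "g \<circ> coords \<phi>"
  have hom: "?p (v, t *\<^sub>R x) = t ^ k * ?p (v, x)" for v t x
    by (simp add: coords_scale assms(2))
  obtain v0 x0 where nz: "?p (v0, x0) \<noteq> 0"
    using assms(1,3) by (metis comp_apply surjD surj_pair)
  show ?thesis
    unfolding cov_order_def
  proof (rule Least_equality)
    show "\<forall>v x. \<exists>q. degree q \<le> k \<and> (\<forall>t. ?p (v, t *\<^sub>R x) = poly q t)"
    proof (intro allI)
      fix v x
      show "\<exists>q. degree q \<le> k \<and> (\<forall>t. ?p (v, t *\<^sub>R x) = poly q t)"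
        unfolding hom
        by (rule exI[of _ "monom (?p (v, x)) k"]) (simp add: degree_monom_le poly_monom mult.commute)
    qed
  next
    fix l assume "\<forall>v x. \<exists>q. degree q \<le> l \<and> (\<forall>t. ?p (v, t *\<^sub>R x) = poly q t)"
    then obtain q where q: "degree q \<le> l" "\<And>t. ?p (v0, t *\<^sub>R x0) = poly q t" by blast
    have "poly q = poly (monom (?p (v0, x0)) k)"
      unfolding fun_eq_iff q(2)[symmetric] hom by (simp add: poly_monom mult.commute)
    then have "q = monom (?p (v0, x0)) k" by (simp add: poly_eq_poly_eq_iff)
    then show "k \<le> l" using q(1) nz by (simp add: degree_monom_eq)
  qed
qed

lemma monomial_zscale:
  assumes "m \<in> monomials k"
  shows "m (zscale t x) = of_real (t ^ k) * m x"
proof (cases x)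
  case (fields a b c d z)
  show ?thesis
    using assms unfolding fields
    by (auto simp: monomials_def zscale_def power_mult_distrib split: if_splits)
qed

lemma monomial_sample_nonzero:
  assumes "m \<in> monomials k"
  shows "Re (m sample) \<noteq> 0" "Im (m sample) \<noteq> 0"
proof -
  have "m \<in> all_monomials" using assms by (auto simp: all_monomials_def)
  moreover have "0 \<notin> (\<lambda>m. Re (m sample)) ` all_monomials" "0 \<notin> (\<lambda>m. Im (m sample)) ` all_monomials"
    unfolding all_monomials_split image_Un sample_monomials_0 sample_covariant_monomials by simp_all
  ultimately show "Re (m sample) \<noteq> 0" "Im (m sample) \<noteq> 0"
    by (metis image_eqI)+
qed

lemma re_part_pullback: "re_part \<phi> m = (\<lambda>x. Re (m x)) \<circ> coords \<phi>"
  and im_part_pullback: "im_part \<phi> m = (\<lambda>x. Im (m x)) \<circ> coords \<phi>"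
  by (simp_all add: re_part_def im_part_def o_def)

lemma cov_order_monomial:
  assumes "surj (coords \<phi>)" "m \<in> monomials k"
  shows "cov_order (re_part \<phi> m) = k" "cov_order (im_part \<phi> m) = k"
  unfolding re_part_pullback im_part_pullback
  by (rule cov_order_pullback[OF assms(1), where y = sample];
      simp only: monomial_zscale[OF assms(2)] Re_complex_of_real_mult Im_complex_of_real_mult
        monomial_sample_nonzero[OF assms(2)] not_False_eq_True)+

lemma cov_order_norm:
  assumes "surj (coords \<phi>)"
  shows "n \<in> invariant_norms \<Longrightarrow> cov_order (re_part \<phi> n) = 0" "cov_order (re_part \<phi> (quad 3 3)) = 2"
proof -
  have one: "wone i (zscale t x) = (if i < 3 then wone i x else t * wone i x)"
    and three: "wthree (zscale t x) = wthree x" for i t x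
    by (auto simp: wone_def wthree_def zscale_def split: prod.splits)
  show "cov_order (re_part \<phi> (quad 3 3)) = 2"
    unfolding re_part_pullback
    by (rule cov_order_pullback[OF assms, where y = sample])
      (simp_all add: Re_sample_norms, simp add: quad_def one power2_eq_square algebra_simps)
  assume n: "n \<in> invariant_norms"
  have "n (zscale t x) = n x" for t x
    using n unfolding invariant_norms_def
    by (elim insertE emptyE) (simp_all add: quad_def one three)
  moreover have "Re (n sample) \<noteq> 0"
    using imageI[OF n, of "\<lambda>m. Re (m sample)"] unfolding Re_sample_norms by auto
  ultimately show "cov_order (re_part \<phi> n) = 0"
    unfolding re_part_pullback by (intro cov_order_pullback[OF assms, where y = sample]) simp_all
qed

lemma order_zero:
  assumes "surj (coords \<phi>)"
  shows "{p \<in> basis_SO2 \<phi>. cov_order p = 0} = (\<lambda>g. g \<circ> coords \<phi>) ` coord_invariants_SO2"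
    "{p \<in> basis_O2 \<phi>. cov_order p = 0} = (\<lambda>g. g \<circ> coords \<phi>) ` coord_invariants_O2"
proof -
  have inv: "cov_order (re_part \<phi> m) = 0" if "m \<in> invariant_norms \<union> monomials 0" for m
    using that cov_order_norm(1)[OF assms] cov_order_monomial(1)[OF assms] by blast
  have inv': "cov_order (im_part \<phi> m) = 0" if "m \<in> monomials 0" for m
    using that cov_order_monomial(2)[OF assms] by blast
  have cov: "cov_order (re_part \<phi> m) \<noteq> 0" "cov_order (im_part \<phi> m) \<noteq> 0"
    if "m \<in> covariant_monomials" for m
  proof -
    have "\<exists>k\<in>{1, 2, 3}. m \<in> monomials k" using that unfolding covariant_monomials_eq by blast
    then obtain k where k: "k \<in> {1, 2, 3}" "m \<in> monomials k" by blast
    then have "k \<noteq> 0" by auto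
    then show "cov_order (re_part \<phi> m) \<noteq> 0" "cov_order (im_part \<phi> m) \<noteq> 0"
      using cov_order_monomial[OF assms k(2)] by auto
  qed
  have z: "cov_order (re_part \<phi> (quad 3 3)) \<noteq> 0" using cov_order_norm(2)[OF assms] by simp
  have SO: "(\<lambda>g. g \<circ> coords \<phi>) ` coord_invariants_SO2
      = re_part \<phi> ` (invariant_norms \<union> monomials 0) \<union> im_part \<phi> ` monomials 0"
    and O: "(\<lambda>g. g \<circ> coords \<phi>) ` coord_invariants_O2 = re_part \<phi> ` (invariant_norms \<union> monomials 0)"
    by (simp_all add: coord_invariants_SO2_def coord_invariants_O2_def image_Un image_image
        re_part_pullback im_part_pullback)
  show "{p \<in> basis_SO2 \<phi>. cov_order p = 0} = (\<lambda>g. g \<circ> coords \<phi>) ` coord_invariants_SO2"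
    unfolding SO basis_SO2_def square_norms_split all_monomials_split by (auto simp: inv inv' cov z)
  show "{p \<in> basis_O2 \<phi>. cov_order p = 0} = (\<lambda>g. g \<circ> coords \<phi>) ` coord_invariants_O2"
    unfolding O basis_O2_def square_norms_split all_monomials_split by (auto simp: inv cov z)
qed

section \<open>Transport along the harmonic decomposition\<close>

lemma rot_in_SO2: "rot \<theta> \<in> SO2"
proof -
  have "transpose (rot \<theta>) ** rot \<theta> = mat 1"
    by (simp add: vec_eq_iff forall_2 rot_def matrix_matrix_mult_def transpose_def mat_def sum_2
        power2_eq_square[symmetric])
  moreover have "det (rot \<theta>) = 1" by (simp add: rot_def det_2 power2_eq_square[symmetric])
  ultimately show ?thesis by (simp add: SO2_def rotation_matrix_def orthogonal_matrix)
qed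

lemma refl_x_in_O2: "refl_x \<in> O2"
  by (simp add: O2_def orthogonal_matrix vec_eq_iff forall_2 refl_x_def matrix_matrix_mult_def
      transpose_def mat_def sum_2)

lemma SO2_subset_O2: "SO2 \<subseteq> O2"
  by (auto simp: SO2_def O2_def rotation_matrix_def)

lemma rot_refl_in_O2: "rot \<theta> ** refl_x \<in> O2"
  using rot_in_SO2[of \<theta>] refl_x_in_O2 SO2_subset_O2 by (auto simp: O2_def intro: orthogonal_matrix_mul)

lemma SO2_cases:
  assumes "g \<in> SO2"
  obtains \<theta> where "g = rot \<theta>"
proof -
  have "det (rot \<theta>) = 1" for \<theta> by (simp add: rot_def det_2 power2_eq_square[symmetric])
  moreover have "det refl_x = - 1" by (simp add: refl_x_def det_2)
  ultimately have "det (rot \<theta> ** refl_x) = - 1" for \<theta> by (simp add: det_mul)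
  moreover have "det g = 1" using assms by (simp add: SO2_def rotation_matrix_def)
  ultimately show ?thesis
    using O2_cases[of g thesis] that SO2_subset_O2 assms by (metis one_neq_neg_one subsetD)
qed

lemma harm_act_rot_refl: "harm_act n (rot \<theta> ** refl_x) w = cis (real n * \<theta>) * cnj w"
proof -
  have "rot \<theta> \<in> O2" using rot_in_SO2 SO2_subset_O2 by blast
  then show ?thesis by (simp add: harm_act_mult refl_x_in_O2 harm_act_rot harm_act_refl)
qed

lemma coords_equivariant:
  assumes "harmonic_decomposition \<phi>"
  shows "coords \<phi> (tensor_act (rot \<theta>) T, rot \<theta> *v x) = turn \<theta> (coords \<phi> (T, x))"
    and "coords \<phi> (tensor_act (rot \<theta> ** refl_x) T, (rot \<theta> ** refl_x) *v x)
      = turn \<theta> (conjugate (coords \<phi> (T, x)))"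
proof -
  have act: "\<phi> (tensor_act g T) = (case \<phi> T of (a, b, c, d) \<Rightarrow>
      (harm_act 1 g a, harm_act 1 g b, harm_act 1 g c, harm_act 3 g d))" if "g \<in> O2" for g
    using assms that unfolding harmonic_decomposition_def by blast
  have O2: "rot \<theta> \<in> O2" using rot_in_SO2 SO2_subset_O2 by blast
  have v1: "Complex ((rot \<theta> *v x) $ 1) ((rot \<theta> *v x) $ 2) = cis \<theta> * Complex (x $ 1) (x $ 2)"
    by (simp add: rot_def matrix_vector_mult_def sum_2 complex_eq_iff)
  have v2: "Complex (((rot \<theta> ** refl_x) *v x) $ 1) (((rot \<theta> ** refl_x) *v x) $ 2)
      = cis \<theta> * cnj (Complex (x $ 1) (x $ 2))"
    by (simp add: rot_def refl_x_def matrix_vector_mult_def matrix_matrix_mult_def sum_2 complex_eq_iff)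
  show "coords \<phi> (tensor_act (rot \<theta>) T, rot \<theta> *v x) = turn \<theta> (coords \<phi> (T, x))"
    unfolding coords_def prod.case act[OF O2] v1
    by (cases "\<phi> T") (simp add: turn_def harm_act_rot)
  show "coords \<phi> (tensor_act (rot \<theta> ** refl_x) T, (rot \<theta> ** refl_x) *v x)
      = turn \<theta> (conjugate (coords \<phi> (T, x)))"
    unfolding coords_def prod.case act[OF rot_refl_in_O2] v2
    by (cases "\<phi> T") (simp add: turn_def conjugate_def harm_act_rot_refl)
qed

lemma coords_linear:
  assumes "harmonic_decomposition \<phi>"
  shows "linear (coords \<phi>)" "bij (coords \<phi>)"
proof -
  have lin: "linear \<phi>" and bij: "bij \<phi>" using assms by (simp_all add: harmonic_decomposition_def)
  define h :: "(complex \<times> complex \<times> complex \<times> complex) \<times> (real^2) \<Rightarrow> coords" where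
    "h = (\<lambda>((a, b, c, d), x). (a, b, c, d, Complex (x $ 1) (x $ 2)))"
  have eq: "coords \<phi> (T, x) = h (\<phi> T, x)" for T x
    by (cases "\<phi> T") (simp add: coords_def h_def)
  have "linear h" by (rule linearI) (auto simp: h_def complex_eq_iff)
  then show "linear (coords \<phi>)"
    by (intro linearI) (auto simp: eq linear_add[OF lin] linear_cmul[OF lin]
        simp flip: linear_add[of h] linear_cmul[of h])
  have "inj h"
    by (rule injI) (auto simp: h_def vec_eq_iff forall_2)
  then have "inj (coords \<phi>)"
    using bij by (intro injI) (auto simp: eq inj_eq bij_def)
  moreover have "surj (coords \<phi>)"
  proof (rule surjI)
    fix y :: coords
    show "coords \<phi> (inv \<phi> (case y of (a, b, c, d, z) \<Rightarrow> (a, b, c, d)),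
        case y of (a, b, c, d, z) \<Rightarrow> vector [Re z, Im z]) = y"
      by (cases y) (simp add: eq h_def surj_f_inv_f[OF bij_is_surj[OF bij]] complex_eq_iff)
  qed
  ultimately show "bij (coords \<phi>)" by (simp add: bij_def)
qed

lemma real_polynomial_pullback_iff:
  fixes K :: "'a::euclidean_space \<Rightarrow> 'b::euclidean_space"
  assumes "linear K" "bij K"
  shows "real_polynomial_function (P \<circ> K) \<longleftrightarrow> real_polynomial_function P"
proof
  obtain L where L: "linear L" "K \<circ> L = id"
    using linear_surjective_right_inverse[OF assms(1) bij_is_surj[OF assms(2)]] by blast
  have "polynomial_function L"
    using L(1) by (intro polynomial_function_bounded_linear) (simp add: linear_conv_bounded_linear)
  moreover assume "real_polynomial_function (P \<circ> K)"
  ultimately have "real_polynomial_function ((P \<circ> K) \<circ> L)"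
    by (rule real_polynomial_function_compose)
  then show "real_polynomial_function P" by (simp add: o_assoc[symmetric] L(2))
next
  assume "real_polynomial_function P"
  then show "real_polynomial_function (P \<circ> K)"
    by (intro real_polynomial_function_compose polynomial_function_bounded_linear)
      (use assms in \<open>simp_all add: linear_conv_bounded_linear\<close>)
qed

text \<open>Every element of \<open>O2\<close> is \<open>rot \<theta>\<close> or \<open>rot \<theta> ** refl_x\<close>, and these act as \<open>turn \<theta>\<close> and
  \<open>turn \<theta> \<circ> conjugate\<close>.\<close>
lemma Cov_pullback:
  assumes "harmonic_decomposition \<phi>"
  shows "Cov SO2 tensor_act = (\<lambda>g. g \<circ> coords \<phi>) ` inv_rot"
    and "Cov O2 tensor_act = (\<lambda>g. g \<circ> coords \<phi>) ` inv_rot_refl"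
proof -
  let ?K = "coords \<phi>"
  note lin = coords_linear[OF assms] and eqv = coords_equivariant[OF assms]
  have surj: "surj ?K" by (rule bij_is_surj[OF lin(2)])
  have onto: "\<exists>P. p = P \<circ> ?K" for p :: "tensor3 \<times> (real^2) \<Rightarrow> real"
    by (rule exI[of _ "p \<circ> inv ?K"])
      (simp add: fun_eq_iff inv_f_f[OF bij_is_inj[OF lin(2)]])
  have all: "(\<forall>T x. Q (?K (T, x))) \<longleftrightarrow> (\<forall>y. Q y)" for Q
    using surj by (metis surjD surj_pair)
  have SO: "(\<forall>g\<in>SO2. \<forall>v. (P \<circ> ?K) ((\<lambda>(v, x). (tensor_act g v, g *v x)) v) = (P \<circ> ?K) v)
      \<longleftrightarrow> (\<forall>\<theta> y. P (turn \<theta> y) = P y)" for P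
  proof -
    have "(\<forall>g\<in>SO2. \<forall>v. (P \<circ> ?K) ((\<lambda>(v, x). (tensor_act g v, g *v x)) v) = (P \<circ> ?K) v)
        \<longleftrightarrow> (\<forall>\<theta> T x. P (?K (tensor_act (rot \<theta>) T, rot \<theta> *v x)) = P (?K (T, x)))"
      using rot_in_SO2 by (auto elim!: SO2_cases)
    also have "\<dots> \<longleftrightarrow> (\<forall>\<theta> y. P (turn \<theta> y) = P y)"
      unfolding eqv using all[of "\<lambda>y. P (turn \<theta> y) = P y" for \<theta>] by auto
    finally show ?thesis .
  qed
  have turn_0: "turn 0 y = y" for y by (simp add: turn_def split: prod.splits)
  have O: "(\<forall>g\<in>O2. \<forall>v. (P \<circ> ?K) ((\<lambda>(v, x). (tensor_act g v, g *v x)) v) = (P \<circ> ?K) v)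
      \<longleftrightarrow> (\<forall>\<theta> y. P (turn \<theta> y) = P y) \<and> (\<forall>y. P (conjugate y) = P y)" for P
  proof -
    have "(\<forall>g\<in>O2. \<forall>v. (P \<circ> ?K) ((\<lambda>(v, x). (tensor_act g v, g *v x)) v) = (P \<circ> ?K) v)
        \<longleftrightarrow> (\<forall>\<theta> T x. P (?K (tensor_act (rot \<theta>) T, rot \<theta> *v x)) = P (?K (T, x)))
          \<and> (\<forall>\<theta> T x. P (?K (tensor_act (rot \<theta> ** refl_x) T, (rot \<theta> ** refl_x) *v x)) = P (?K (T, x)))"
      using subsetD[OF SO2_subset_O2 rot_in_SO2] rot_refl_in_O2 by (auto elim!: O2_cases)
    also have "\<dots> \<longleftrightarrow> (\<forall>\<theta> y. P (turn \<theta> y) = P y) \<and> (\<forall>\<theta> y. P (turn \<theta> (conjugate y)) = P y)"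
      unfolding eqv using all[of "\<lambda>y. P (turn \<theta> y) = P y" for \<theta>]
        all[of "\<lambda>y. P (turn \<theta> (conjugate y)) = P y" for \<theta>] by auto
    also have "\<dots> \<longleftrightarrow> (\<forall>\<theta> y. P (turn \<theta> y) = P y) \<and> (\<forall>y. P (conjugate y) = P y)"
      by (metis turn_0)
    finally show ?thesis .
  qed
  have memSO: "P \<circ> ?K \<in> Cov SO2 tensor_act \<longleftrightarrow> P \<in> inv_rot" for P
    unfolding Cov_def Inv_def inv_rot_def mem_Collect_eq SO real_polynomial_pullback_iff[OF lin] ..
  have memO: "P \<circ> ?K \<in> Cov O2 tensor_act \<longleftrightarrow> P \<in> inv_rot_refl" for P
    unfolding Cov_def Inv_def inv_rot_def inv_rot_refl_def mem_Collect_eq O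
      real_polynomial_pullback_iff[OF lin] by blast
  show "Cov SO2 tensor_act = (\<lambda>g. g \<circ> ?K) ` inv_rot"
    using onto memSO by (metis (no_types, lifting) image_iff set_eqI)
  show "Cov O2 tensor_act = (\<lambda>g. g \<circ> ?K) ` inv_rot_refl"
    using onto memO by (metis (no_types, lifting) image_iff set_eqI)
qed

theorem theorem8p2:
  fixes \<phi> :: "tensor3 \<Rightarrow> complex \<times> complex \<times> complex \<times> complex"
  assumes "harmonic_decomposition \<phi>"
  shows "card all_monomials = 26 \<and>
    (\<forall>k. \<forall>m\<in>monomials k. cov_order (re_part \<phi> m) = k \<and> cov_order (im_part \<phi> m) = k) \<and>
    minimal_integrity_basis (Cov SO2 tensor_act) (basis_SO2 \<phi>) \<and>
    card (basis_SO2 \<phi>) = 57 \<and> card {p \<in> basis_SO2 \<phi>. cov_order p = 0} = 30 \<and>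
    minimal_integrity_basis (Cov O2 tensor_act) (basis_O2 \<phi>) \<and>
    card (basis_O2 \<phi>) = 31 \<and> card {p \<in> basis_O2 \<phi>. cov_order p = 0} = 17"
proof -
  note lin = coords_linear[OF assms]
  have surj: "surj (coords \<phi>)" by (rule bij_is_surj[OF lin(2)])
  have card: "card ((\<lambda>g. g \<circ> coords \<phi>) ` B) = card B" for B :: "(coords \<Rightarrow> real) set"
    by (rule card_image) (rule inj_on_subset[OF inj_pullback[OF surj] subset_UNIV])
  show ?thesis
    unfolding order_zero[OF surj] unfolding basis_pullback Cov_pullback[OF assms] card card_basis
    using cov_order_monomial[OF surj]
      minimal_integrity_basis_pullback[OF lin(1) surj minimal_basis_SO2]
      minimal_integrity_basis_pullback[OF lin(1) surj minimal_basis_O2]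
    by blast
qed

end
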